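(* Let $P(x,D)=\sum_{|\alpha|\le m}c_\alpha(x)D^\alpha$ be a differential operator with coefficients in $\mathcal{G}(\mathbb{R}^n)$ which is $\mathcal{G}$-elliptic in $x_0\in\mathbb{R}^n$ (i.e. the constant coefficient operator $P(x_0,D)$ is $\mathcal{G}$-elliptic). Then $P(x,D)$ can be written in the form $$P(x,D)=P_0(D)+\sum_{j=1}^rc_j(x)P_j(D)$$ with - $c_j\in\mathcal{G}(\mathbb{R}^n)$, $c_j(x_0)=0$, and $P_0(D)$, $P_j(D)$ ($j=1,\dots,r$) operators with constant coefficients in $\widetilde{\mathbb{C}}$; - $\widetilde{P_0}$ invertible in some point of $\mathbb{R}^n$; - $P_0(D)$ stronger than every $P_j(D)$.
   Context: Nets are indexed by $\varepsilon\in(0,1]$. A net $(\lambda_\varepsilon)_\varepsilon$ of complex numbers is moderate if $|\lambda_\varepsilon|=O(\varepsilon^{-N})$ as $\varepsilon\to0$ for some $N\in\mathbb{N}$, negligible if $|\lambda_\varepsilon|=O(\varepsilon^q)$ for all $q\in\mathbb{N}$. $\widetilde{\mathbb{C}}$ (resp. $\widetilde{\mathbb{R}}$) is the ring of complex (resp. real) moderate nets modulo negligible nets. $\mathcal{G}(\Omega)$ is the algebra of nets $(u_\varepsilon)_\varepsilon$ in $\mathcal{C}^\infty(\Omega)$ such that for all $K\Subset\Omega$, $\alpha\in\mathbb{N}^n$ there is $N$ with $\sup_K|\partial^\alpha u_\varepsilon|=O(\varepsilon^{-N})$, modulo nets for which this is $O(\varepsilon^q)$ for all $K,\alpha$ and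 all $q\in\mathbb{N}$. For $u\in\mathcal{G}(\Omega)$, $u(x_0)=[(u_\varepsilon(x_0))_\varepsilon]\in\widetilde{\mathbb{C}}$; $P(x_0,D)=\sum_{|\alpha|\le m}c_\alpha(x_0)D^\alpha$, $D=-i\partial$. For a constant coefficient operator $P(D)=\sum_{|\alpha|\le m}c_\alpha D^\alpha$, $c_\alpha\in\widetilde{\mathbb{C}}$, $P(\xi)=\sum_{|\alpha|\le m}c_\alpha\xi^\alpha$ and $P_m(\xi)=\sum_{|\alpha|=m}c_\alpha\xi^\alpha$; representatives $(P_\varepsilon)_\varepsilon$, $(P_{m,\varepsilon})_\varepsilon$ are the nets of polynomials obtained by replacing each $c_\alpha$ by a representative. For a polynomial $Q$, $\widetilde Q(\xi)=(\sum_\alpha|\partial^\alpha Q(\xi)|^2)^{1/2}$, and $\widetilde P(\xi)=[(\widetilde{P_\varepsilon}(\xi))_\varepsilon]\in\widetilde{\mathbb{R}}$; "$\widetilde P$ invertible in $\xi$" means $\widetilde P(\xi)$ is invertible in $\widetilde{\mathbb{R}}$. $P(D)$ is $\mathcal{G}$-elliptic if there exist a representative $(P_{m,\varepsilon})_\varepsilon$ of $P_m$, $c>0$ and $a\in\mathbb{R}$ with $|P_{m,\varepsilon}(\xi)|\ge c\,\varepsilon^a|\xi|^m$ for all $\varepsilon\in(0,1]$, $\xi\in\mathbb{R}^n$. $P(D)$ is stronger than $Q(D)$ if there exist representatives $(P_\varepsilon)_\varepsilon$, $(Q_\varepsilon)_\varepsilon$ and a moderate net $(\lambda_\varepsilon)_\varepsilon$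 with $\widetilde{Q_\varepsilon}(\xi)\le\lambda_\varepsilon\widetilde{P_\varepsilon}(\xi)$ for all $\xi\in\mathbb{R}^n$, $\varepsilon\in(0,1]$. *)

theory Defs
  imports "HOL-Analysis.Analysis" "HOL-Library.Landau_Symbols"
begin

section \<open>Smooth functions and partial derivatives\<close>

definition pderiv_at :: "'n \<Rightarrow> (real^'n \<Rightarrow> complex) \<Rightarrow> real^'n \<Rightarrow> complex" where
  "pderiv_at i f x = frechet_derivative f (at x) (axis i 1)"

text \<open>\<open>foldr pderiv_at [i\<^sub>1, \<dots>, i\<^sub>k] f\<close> is the iterated partial derivative
  \<open>\<partial>\<^bsub>i\<^sub>1\<^esub> \<dots> \<partial>\<^bsub>i\<^sub>k\<^esub> f\<close>.\<close>

definition smooth :: "(real^'n::finite \<Rightarrow> complex) \<Rightarrow> bool" where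
  "smooth f \<longleftrightarrow> (\<forall>is x. foldr pderiv_at is f differentiable (at x))"

abbreviation mi_order :: "('n::finite \<Rightarrow> nat) \<Rightarrow> nat" where
  "mi_order \<alpha> \<equiv> (\<Sum>i\<in>UNIV. \<alpha> i)"

text \<open>The derivative \<open>\<partial>\<^sup>\<alpha>\<close>.  The order of differentiation is left to the choice operator; for
  smooth functions it does not matter, see \<open>mderiv_eq\<close> below.\<close>

definition mderiv :: "('n::finite \<Rightarrow> nat) \<Rightarrow> (real^'n \<Rightarrow> complex) \<Rightarrow> real^'n \<Rightarrow> complex" where
  "mderiv \<alpha> f = foldr pderiv_at (SOME is. \<forall>i. count_list is i = \<alpha> i) f"

lemma smooth_coinduct:
  assumes "X f" "\<And>f x. X f \<Longrightarrow> f differentiable (at x)" "\<And>f i. X f \<Longrightarrow> X (pderiv_at i f)"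
  shows "smooth f"
proof -
  have "X (foldr pderiv_at is f)" for "is" using assms by (induction "is") auto
  then show ?thesis using assms(2) by (simp add: smooth_def)
qed

lemma smooth_differentiable: "smooth f \<Longrightarrow> f differentiable (at x)"
  unfolding smooth_def by (metis foldr.simps(1) id_apply)

lemma smooth_pderiv: "smooth f \<Longrightarrow> smooth (pderiv_at i f)"
proof -
  assume "smooth f"
  then have "foldr pderiv_at (is @ [i]) f differentiable (at x)" for "is" x
    unfolding smooth_def by blast
  then show ?thesis by (simp add: smooth_def)
qed

lemma smooth_foldr: "smooth f \<Longrightarrow> smooth (foldr pderiv_at is f)"
  by (induction "is") (auto intro: smooth_pderiv)

lemma smooth_continuous: "smooth f \<Longrightarrow> continuous_on A f"
  by (meson continuous_at_imp_continuous_on differentiable_imp_continuous_within smooth_differentiable)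

lemma pderiv_atI: "(f has_derivative f') (at x) \<Longrightarrow> pderiv_at i f x = f' (axis i 1)"
  unfolding pderiv_at_def using frechet_derivative_at by metis

lemma pderiv_const [simp]: "pderiv_at i (\<lambda>x. c) = (\<lambda>x. 0)"
  by (rule ext, rule trans[OF pderiv_atI]) (rule has_derivative_const, simp)

lemma pderiv_add:
  "f differentiable (at x) \<Longrightarrow> g differentiable (at x) \<Longrightarrow>
    pderiv_at i (\<lambda>x. f x + g x) x = pderiv_at i f x + pderiv_at i g x"
  by (rule trans[OF pderiv_atI[OF has_derivative_add]])
     (auto simp: frechet_derivative_works[symmetric] pderiv_at_def)

lemma pderiv_mult:
  "f differentiable (at x) \<Longrightarrow> g differentiable (at x) \<Longrightarrow>
    pderiv_at i (\<lambda>x. f x * g x) x = f x * pderiv_at i g x + pderiv_at i f x * g x"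
  by (rule trans[OF pderiv_atI[OF has_derivative_mult]])
     (auto simp: frechet_derivative_works[symmetric] pderiv_at_def)

lemma smooth_const [simp]: "smooth (\<lambda>x. c)"
  by (rule smooth_coinduct[where X = "\<lambda>f. \<exists>c. f = (\<lambda>x. c)"]) auto

inductive prodsum :: "(real^'n::finite \<Rightarrow> complex) \<Rightarrow> bool" where
  prodsum_prod: "smooth f \<Longrightarrow> smooth g \<Longrightarrow> prodsum (\<lambda>x. f x * g x)"
| prodsum_add: "prodsum f \<Longrightarrow> prodsum g \<Longrightarrow> prodsum (\<lambda>x. f x + g x)"

lemma prodsum_differentiable: "prodsum f \<Longrightarrow> f differentiable (at x)"
  by (induction rule: prodsum.induct) (auto intro: differentiable_mult smooth_differentiable)

lemma prodsum_pderiv: "prodsum f \<Longrightarrow> prodsum (pderiv_at i f)"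
proof (induction rule: prodsum.induct)
  case (prodsum_prod f g)
  have "pderiv_at i (\<lambda>x. f x * g x) = (\<lambda>x. f x * pderiv_at i g x + pderiv_at i f x * g x)"
    by (rule ext, rule pderiv_mult) (use prodsum_prod smooth_differentiable in auto)
  then show ?case using prodsum_prod
    by (auto intro!: prodsum.prodsum_add prodsum.prodsum_prod smooth_pderiv)
next
  case (prodsum_add f g)
  have "pderiv_at i (\<lambda>x. f x + g x) = (\<lambda>x. pderiv_at i f x + pderiv_at i g x)"
    by (rule ext, rule pderiv_add) (use prodsum_add prodsum_differentiable in auto)
  then show ?case using prodsum_add by (auto intro: prodsum.prodsum_add)
qed

lemma prodsum_smooth: "prodsum f \<Longrightarrow> smooth f"
  by (rule smooth_coinduct[where X = prodsum]) (auto intro: prodsum_differentiable prodsum_pderiv)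

lemma smooth_mult: "smooth f \<Longrightarrow> smooth g \<Longrightarrow> smooth (\<lambda>x. f x * g x)"
  by (rule prodsum_smooth[OF prodsum_prod])

lemma smooth_add:
  assumes "smooth f" "smooth g" shows "smooth (\<lambda>x. f x + g x)"
proof -
  have "prodsum (\<lambda>x. f x * 1 + g x * 1)"
    using assms by (intro prodsum_add prodsum_prod) auto
  then show ?thesis using prodsum_smooth by force
qed

lemma smooth_diff: "smooth f \<Longrightarrow> smooth g \<Longrightarrow> smooth (\<lambda>x. f x - g x)"
  using smooth_add[OF _ smooth_mult[OF smooth_const[of "-1"]], of f g] by simp

lemma smooth_uminus: "smooth f \<Longrightarrow> smooth (\<lambda>x. - f x)"
  using smooth_mult[OF smooth_const[of "-1"], of f] by simp

lemma smooth_sum: "(\<And>a. a \<in> A \<Longrightarrow> smooth (f a)) \<Longrightarrow> smooth (\<lambda>x. \<Sum>a\<in>A. f a x)"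
  by (induction A rule: infinite_finite_induct) (auto intro: smooth_add)

lemma foldr_pderiv_add:
  "smooth f \<Longrightarrow> smooth g \<Longrightarrow>
    foldr pderiv_at is (\<lambda>x. f x + g x) = (\<lambda>x. foldr pderiv_at is f x + foldr pderiv_at is g x)"
proof (induction "is")
  case (Cons i "is")
  then show ?case
    by (auto intro!: pderiv_add smooth_differentiable smooth_foldr)
qed auto

lemma foldr_pderiv_zero [simp]: "foldr pderiv_at is (\<lambda>x. 0) = (\<lambda>x. 0)"
  by (induction "is") auto

lemma foldr_pderiv_cmult:
  "smooth f \<Longrightarrow> foldr pderiv_at is (\<lambda>x. c * f x) = (\<lambda>x. c * foldr pderiv_at is f x)"
proof (induction "is")
  case (Cons i "is")
  have "pderiv_at i (\<lambda>x. c * foldr pderiv_at is f x) x = c * pderiv_at i (foldr pderiv_at is f) x" for x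
    by (subst pderiv_mult) (use Cons smooth_differentiable smooth_foldr in auto)
  then show ?case using Cons by auto
qed auto

lemma foldr_pderiv_diff:
  assumes "smooth f" "smooth g"
  shows "foldr pderiv_at is (\<lambda>x. f x - g x) = (\<lambda>x. foldr pderiv_at is f x - foldr pderiv_at is g x)"
proof -
  have "foldr pderiv_at is (\<lambda>x. f x + (-1) * g x) = (\<lambda>x. foldr pderiv_at is f x + (-1) * foldr pderiv_at is g x)"
    by (subst foldr_pderiv_add)
       (use assms smooth_mult[OF smooth_const] in \<open>auto simp only: foldr_pderiv_cmult\<close>)
  then show ?thesis by simp
qed

lemma foldr_pderiv_sum:
  "(\<And>a. a \<in> A \<Longrightarrow> smooth (f a)) \<Longrightarrow>
    foldr pderiv_at is (\<lambda>x. \<Sum>a\<in>A. f a x) = (\<lambda>x. \<Sum>a\<in>A. foldr pderiv_at is (f a) x)"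
  by (induction A rule: infinite_finite_induct) (auto simp: foldr_pderiv_add smooth_sum)

subsection \<open>Symmetry of mixed derivatives\<close>

lemma second_difference_mvt:
  fixes g gi gji :: "real^'n::finite \<Rightarrow> real"
  assumes gi: "\<And>x. ((\<lambda>t. g (x + t *\<^sub>R axis i 1)) has_real_derivative gi x) (at 0)"
    and gji: "\<And>x. ((\<lambda>t. gi (x + t *\<^sub>R axis j 1)) has_real_derivative gji x) (at 0)"
    and h: "h > 0"
  shows "\<exists>s\<in>{0..h}. \<exists>t\<in>{0..h}.
    g (x + h *\<^sub>R axis i 1 + h *\<^sub>R axis j 1) - g (x + h *\<^sub>R axis i 1) - g (x + h *\<^sub>R axis j 1) + g x
      = h * h * gji (x + s *\<^sub>R axis i 1 + t *\<^sub>R axis j 1)"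
proof -
  have gi': "((\<lambda>t. g (y + t *\<^sub>R axis i 1)) has_real_derivative gi (y + s *\<^sub>R axis i 1)) (at s)" for y s
    using gi[of "y + s *\<^sub>R axis i 1"] DERIV_shift[of "\<lambda>t. g (y + t *\<^sub>R axis i 1)" _ 0 s]
    by (simp add: algebra_simps)
  have gji': "((\<lambda>t. gi (y + t *\<^sub>R axis j 1)) has_real_derivative gji (y + s *\<^sub>R axis j 1)) (at s)" for y s
    using gji[of "y + s *\<^sub>R axis j 1"] DERIV_shift[of "\<lambda>t. gi (y + t *\<^sub>R axis j 1)" _ 0 s]
    by (simp add: algebra_simps)
  define F where "F = (\<lambda>s. g ((x + h *\<^sub>R axis j 1) + s *\<^sub>R axis i 1) - g (x + s *\<^sub>R axis i 1))"
  have "\<exists>s. 0 < s \<and> s < h \<and>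
      F h - F 0 = (h - 0) * (gi ((x + h *\<^sub>R axis j 1) + s *\<^sub>R axis i 1) - gi (x + s *\<^sub>R axis i 1))"
    unfolding F_def by (rule MVT2[OF h]) (intro DERIV_diff gi')
  then obtain s where s: "0 < s" "s < h"
    and F: "F h - F 0 = h * (gi ((x + h *\<^sub>R axis j 1) + s *\<^sub>R axis i 1) - gi (x + s *\<^sub>R axis i 1))"
    by auto
  have "\<exists>t. 0 < t \<and> t < h \<and>
      gi ((x + s *\<^sub>R axis i 1) + h *\<^sub>R axis j 1) - gi ((x + s *\<^sub>R axis i 1) + 0 *\<^sub>R axis j 1)
        = (h - 0) * gji ((x + s *\<^sub>R axis i 1) + t *\<^sub>R axis j 1)"
    by (rule MVT2[OF h]) (rule gji')
  then obtain t where t: "0 < t" "t < h"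
    and G: "gi ((x + s *\<^sub>R axis i 1) + h *\<^sub>R axis j 1) - gi (x + s *\<^sub>R axis i 1)
        = h * gji ((x + s *\<^sub>R axis i 1) + t *\<^sub>R axis j 1)"
    by auto
  have "F h - F 0 = h * (h * gji (x + s *\<^sub>R axis i 1 + t *\<^sub>R axis j 1))"
    using F G by (simp add: algebra_simps)
  then have "g (x + h *\<^sub>R axis i 1 + h *\<^sub>R axis j 1) - g (x + h *\<^sub>R axis i 1) - g (x + h *\<^sub>R axis j 1) + g x
      = h * h * gji (x + s *\<^sub>R axis i 1 + t *\<^sub>R axis j 1)"
    unfolding F_def by (simp add: algebra_simps)
  with s t show ?thesis by (intro bexI[of _ s] bexI[of _ t]) auto
qed

lemma real_clairaut:
  fixes g gi gj gji gij :: "real^'n::finite \<Rightarrow> real"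
  assumes "\<And>x. ((\<lambda>t. g (x + t *\<^sub>R axis i 1)) has_real_derivative gi x) (at 0)"
    and "\<And>x. ((\<lambda>t. g (x + t *\<^sub>R axis j 1)) has_real_derivative gj x) (at 0)"
    and "\<And>x. ((\<lambda>t. gi (x + t *\<^sub>R axis j 1)) has_real_derivative gji x) (at 0)"
    and "\<And>x. ((\<lambda>t. gj (x + t *\<^sub>R axis i 1)) has_real_derivative gij x) (at 0)"
    and c: "isCont gji x" "isCont gij x"
  shows "gij x = gji x"
proof -
  define h where "h = (\<lambda>n. inverse (real (Suc n)))"
  have hp: "h n > 0" for n by (simp add: h_def)
  have h0: "h \<longlonglongrightarrow> 0" unfolding h_def by (rule LIMSEQ_inverse_real_of_nat)
  have "\<forall>n. \<exists>s t s' t'. s \<in> {0..h n} \<and> t \<in> {0..h n} \<and> s' \<in> {0..h n} \<and> t' \<in> {0..h n} \<and>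
      gji (x + s *\<^sub>R axis i 1 + t *\<^sub>R axis j 1) = gij (x + s' *\<^sub>R axis j 1 + t' *\<^sub>R axis i 1)"
  proof
    fix n
    obtain s t where st: "s \<in> {0..h n}" "t \<in> {0..h n}"
      "g (x + h n *\<^sub>R axis i 1 + h n *\<^sub>R axis j 1) - g (x + h n *\<^sub>R axis i 1) - g (x + h n *\<^sub>R axis j 1) + g x
        = h n * h n * gji (x + s *\<^sub>R axis i 1 + t *\<^sub>R axis j 1)"
      using second_difference_mvt[OF assms(1,3) hp] by blast
    obtain s' t' where st': "s' \<in> {0..h n}" "t' \<in> {0..h n}"
      "g (x + h n *\<^sub>R axis j 1 + h n *\<^sub>R axis i 1) - g (x + h n *\<^sub>R axis j 1) - g (x + h n *\<^sub>R axis i 1) + g x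
        = h n * h n * gij (x + s' *\<^sub>R axis j 1 + t' *\<^sub>R axis i 1)"
      using second_difference_mvt[OF assms(2,4) hp] by blast
    have "h n * h n * gji (x + s *\<^sub>R axis i 1 + t *\<^sub>R axis j 1)
        = h n * h n * gij (x + s' *\<^sub>R axis j 1 + t' *\<^sub>R axis i 1)"
      unfolding st(3)[symmetric] st'(3)[symmetric] by (simp add: algebra_simps)
    then have "gji (x + s *\<^sub>R axis i 1 + t *\<^sub>R axis j 1) = gij (x + s' *\<^sub>R axis j 1 + t' *\<^sub>R axis i 1)"
      using hp[of n] by auto
    with st st' show "\<exists>s t s' t'. s \<in> {0..h n} \<and> t \<in> {0..h n} \<and> s' \<in> {0..h n} \<and> t' \<in> {0..h n} \<and>
      gji (x + s *\<^sub>R axis i 1 + t *\<^sub>R axis j 1) = gij (x + s' *\<^sub>R axis j 1 + t' *\<^sub>R axis i 1)"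
      by blast
  qed
  then obtain s t s' t' where b: "\<And>n. s n \<in> {0..h n}" "\<And>n. t n \<in> {0..h n}"
      "\<And>n. s' n \<in> {0..h n}" "\<And>n. t' n \<in> {0..h n}"
    and eq: "\<And>n. gji (x + s n *\<^sub>R axis i 1 + t n *\<^sub>R axis j 1) = gij (x + s' n *\<^sub>R axis j 1 + t' n *\<^sub>R axis i 1)"
    by metis
  have z: "f \<longlonglongrightarrow> 0" if "\<And>n. f n \<in> {0..h n}" for f
    by (rule tendsto_sandwich[OF _ _ tendsto_const h0]) (use that in auto)
  have lim: "(\<lambda>n. x + p n *\<^sub>R axis k 1 + q n *\<^sub>R axis l 1) \<longlonglongrightarrow> x"
    if "p \<longlonglongrightarrow> 0" "q \<longlonglongrightarrow> 0" for p q :: "nat \<Rightarrow> real" and k l :: 'n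
  proof -
    have "(\<lambda>n. x + p n *\<^sub>R axis k 1 + q n *\<^sub>R axis l 1) \<longlonglongrightarrow> x + 0 *\<^sub>R axis k 1 + 0 *\<^sub>R axis l 1"
      by (intro tendsto_intros that)
    then show ?thesis by simp
  qed
  have 1: "(\<lambda>n. gji (x + s n *\<^sub>R axis i 1 + t n *\<^sub>R axis j 1)) \<longlonglongrightarrow> gji x"
    by (rule isCont_tendsto_compose[OF c(1)]) (intro lim z b)
  have 2: "(\<lambda>n. gij (x + s' n *\<^sub>R axis j 1 + t' n *\<^sub>R axis i 1)) \<longlonglongrightarrow> gij x"
    by (rule isCont_tendsto_compose[OF c(2)]) (intro lim z b)
  show ?thesis using LIMSEQ_unique[OF 1] 2 eq by auto
qed

lemma pderiv_line:
  assumes "f differentiable (at x)" and L: "bounded_linear L"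
  shows "((\<lambda>t. L (f (x + t *\<^sub>R axis i 1))) has_real_derivative L (pderiv_at i f x)) (at 0)"
proof -
  interpret L: bounded_linear L by fact
  have f: "(f has_derivative frechet_derivative f (at x)) (at (x + 0 *\<^sub>R axis i 1))"
    using assms(1) frechet_derivative_works by auto
  have "((\<lambda>t. x + t *\<^sub>R axis i 1) has_derivative (\<lambda>t. t *\<^sub>R axis i 1)) (at 0)"
    by (auto intro!: derivative_eq_intros)
  from has_derivative_compose[OF this f]
  have "((\<lambda>t. L (f (x + t *\<^sub>R axis i 1))) has_derivative
      (\<lambda>t. L (frechet_derivative f (at x) (t *\<^sub>R axis i 1)))) (at 0)"
    by (rule L.has_derivative)
  moreover have "linear (frechet_derivative f (at x))"
    using f has_derivative_linear by auto
  ultimately show ?thesis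
    by (simp add: has_field_derivative_def pderiv_at_def linear_scale L.scaleR mult.commute[of _ "L _"])
qed

lemma pderiv_commute:
  assumes "smooth f"
  shows "pderiv_at i (pderiv_at j f) = pderiv_at j (pderiv_at i f)"
proof
  fix x
  have d: "smooth f" "smooth (pderiv_at i f)" "smooth (pderiv_at j f)"
    "smooth (pderiv_at i (pderiv_at j f))" "smooth (pderiv_at j (pderiv_at i f))"
    using assms by (auto intro!: smooth_pderiv)
  have "L (pderiv_at i (pderiv_at j f) x) = L (pderiv_at j (pderiv_at i f) x)"
    if L: "bounded_linear L" for L :: "complex \<Rightarrow> real"
  proof (rule real_clairaut[where g = "\<lambda>x. L (f x)"])
    show "isCont (\<lambda>x. L (pderiv_at j (pderiv_at i f) x)) x" "isCont (\<lambda>x. L (pderiv_at i (pderiv_at j f) x)) x"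
      by (intro bounded_linear.isCont[OF L] differentiable_imp_continuous_within smooth_differentiable d)+
  qed (auto intro!: pderiv_line L smooth_differentiable d)
  from this[OF bounded_linear_Re] this[OF bounded_linear_Im]
  show "pderiv_at i (pderiv_at j f) x = pderiv_at j (pderiv_at i f) x"
    by (simp add: complex_eq_iff)
qed

lemma foldr_pderiv_move:
  "smooth f \<Longrightarrow> pderiv_at i (foldr pderiv_at is f) = foldr pderiv_at is (pderiv_at i f)"
  by (induction "is") (auto simp: pderiv_commute[of "foldr pderiv_at _ f"] smooth_foldr)

lemma foldr_pderiv_perm:
  assumes "smooth f" "mset is = mset js"
  shows "foldr pderiv_at is f = foldr pderiv_at js f"
  using assms(2)
proof (induction "is" arbitrary: js)
  case (Cons i "is")
  then have "i \<in> set js" by (metis list.set_intros(1) mset_eq_setD)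
  then obtain as bs where js: "js = as @ i # bs" by (meson split_list)
  then have "mset is = mset (as @ bs)" using Cons.prems by simp
  then have "foldr pderiv_at is f = foldr pderiv_at (as @ bs) f" by (rule Cons.IH)
  then show ?case
    using foldr_pderiv_move[OF smooth_foldr[OF assms(1)], of i as bs] js by simp
qed simp

lemma ex_count_list: "\<exists>is. \<forall>i. count_list is i = (\<alpha> :: 'n::finite \<Rightarrow> nat) i"
proof -
  obtain "is" where "mset is = Abs_multiset \<alpha>" using ex_mset by blast
  moreover have "count (Abs_multiset \<alpha>) = \<alpha>" by (simp add: Abs_multiset_inverse)
  ultimately show ?thesis by (metis count_mset)
qed

lemma mderiv_eq:
  assumes "smooth f" "\<And>i. count_list is i = \<alpha> i"
  shows "mderiv \<alpha> f = foldr pderiv_at is f"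
proof -
  have "\<forall>i. count_list (SOME is. \<forall>i. count_list is i = \<alpha> i) i = \<alpha> i"
    by (rule someI_ex[OF ex_count_list])
  then show ?thesis unfolding mderiv_def using assms
    by (intro foldr_pderiv_perm) (auto intro!: multiset_eqI simp: count_mset)
qed

lemma mderiv_zero_index [simp]: "mderiv (\<lambda>i. 0) f = f"
proof -
  have "\<forall>i :: 'a. count_list (SOME is. \<forall>i. count_list is i = 0) i = 0"
    by (rule someI_ex[OF ex_count_list[of "\<lambda>i. 0"]])
  then show ?thesis unfolding mderiv_def
    by (metis count_list_0_iff list.set_intros(1) neq_Nil_conv foldr.simps(1) id_apply)
qed


section \<open>Generalized numbers\<close>

text \<open>Nets indexed by \<open>(0,1]\<close> are total functions on the reals whose values outside \<open>(0,1]\<close>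
  play no role.\<close>

definition moderate_num :: "(real \<Rightarrow> 'a::real_normed_field) \<Rightarrow> bool" where
  "moderate_num u \<longleftrightarrow> (\<exists>N::nat. (\<lambda>\<epsilon>. norm (u \<epsilon>)) \<in> O[at_right 0](\<lambda>\<epsilon>. \<epsilon> powr - real N))"

definition negligible_num :: "(real \<Rightarrow> 'a::real_normed_field) \<Rightarrow> bool" where
  "negligible_num u \<longleftrightarrow> (\<forall>q::nat. (\<lambda>\<epsilon>. norm (u \<epsilon>)) \<in> O[at_right 0](\<lambda>\<epsilon>. \<epsilon> powr real q))"

definition gen_num_rel :: "(real \<Rightarrow> 'a::real_normed_field) \<Rightarrow> (real \<Rightarrow> 'a) \<Rightarrow> bool" where
  "gen_num_rel u v \<longleftrightarrow> moderate_num u \<and> moderate_num v \<and> negligible_num (\<lambda>\<epsilon>. u \<epsilon> - v \<epsilon>)"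

subsection \<open>Uniform growth bounds\<close>

definition unif_bound :: "'x set \<Rightarrow> real \<Rightarrow> (real \<Rightarrow> 'x \<Rightarrow> 'a::real_normed_field) \<Rightarrow> bool" where
  "unif_bound K r w \<longleftrightarrow> (\<exists>C. \<forall>\<^sub>F \<epsilon> in at_right 0. \<forall>x\<in>K. norm (w \<epsilon> x) \<le> C * \<epsilon> powr r)"

definition unif_mod :: "'x set \<Rightarrow> (real \<Rightarrow> 'x \<Rightarrow> 'a::real_normed_field) \<Rightarrow> bool" where
  "unif_mod K w \<longleftrightarrow> (\<exists>r. unif_bound K r w)"

definition unif_neg :: "'x set \<Rightarrow> (real \<Rightarrow> 'x \<Rightarrow> 'a::real_normed_field) \<Rightarrow> bool" where
  "unif_neg K w \<longleftrightarrow> (\<forall>r. unif_bound K r w)"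

lemma eventually_01: "\<forall>\<^sub>F \<epsilon> in at_right 0. \<epsilon> \<in> {0<..1::real}"
  unfolding eventually_at_right_field by (intro exI[of _ 1]) auto

lemma unif_boundE:
  assumes "unif_bound K r w"
  obtains C where "C \<ge> 0" "\<forall>\<^sub>F \<epsilon> in at_right 0. \<forall>x\<in>K. norm (w \<epsilon> x) \<le> C * \<epsilon> powr r"
proof -
  from assms obtain C where C: "\<forall>\<^sub>F \<epsilon> in at_right 0. \<forall>x\<in>K. norm (w \<epsilon> x) \<le> C * \<epsilon> powr r"
    unfolding unif_bound_def by blast
  have "\<forall>\<^sub>F \<epsilon> in at_right 0. \<forall>x\<in>K. norm (w \<epsilon> x) \<le> \<bar>C\<bar> * \<epsilon> powr r"
    using C by eventually_elim (meson abs_ge_self mult_right_mono order_trans powr_ge_zero)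
  then show ?thesis using that[of "\<bar>C\<bar>"] by simp
qed

lemma unif_bound_mono:
  assumes "unif_bound K r w" "s \<le> r" shows "unif_bound K s w"
proof -
  obtain C where C: "C \<ge> 0" "\<forall>\<^sub>F \<epsilon> in at_right 0. \<forall>x\<in>K. norm (w \<epsilon> x) \<le> C * \<epsilon> powr r"
    using unif_boundE[OF assms(1)] .
  have "\<forall>\<^sub>F \<epsilon> in at_right 0. \<forall>x\<in>K. norm (w \<epsilon> x) \<le> C * \<epsilon> powr s"
    using C(2) eventually_01
  proof eventually_elim
    case (elim \<epsilon>)
    then have "C * \<epsilon> powr r \<le> C * \<epsilon> powr s"
      using C(1) assms(2) by (intro mult_left_mono powr_mono') auto
    with elim show ?case by force
  qed
  then show ?thesis unfolding unif_bound_def by blast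
qed

lemma unif_bound_subset: "unif_bound K r w \<Longrightarrow> L \<subseteq> K \<Longrightarrow> unif_bound L r w"
  unfolding unif_bound_def by (elim exE, rule exI, erule eventually_mono) auto

lemma unif_bound_const_net: "unif_bound {()} r (\<lambda>\<epsilon> _. c \<epsilon>) \<Longrightarrow> unif_bound K r (\<lambda>\<epsilon> _. c \<epsilon>)"
  unfolding unif_bound_def by (elim exE, rule exI, erule eventually_mono) auto

lemma unif_bound_cong:
  "unif_bound K r w \<Longrightarrow> (\<And>\<epsilon> x. \<epsilon> \<in> {0<..1} \<Longrightarrow> x \<in> K \<Longrightarrow> norm (w' \<epsilon> x) \<le> norm (w \<epsilon> x)) \<Longrightarrow> unif_bound K r w'"
  unfolding unif_bound_def
proof (elim exE, rule exI)
  fix C assume C: "\<forall>\<^sub>F \<epsilon> in at_right 0. \<forall>x\<in>K. norm (w \<epsilon> x) \<le> C * \<epsilon> powr r"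
    and le: "\<And>\<epsilon> x. \<epsilon> \<in> {0<..1} \<Longrightarrow> x \<in> K \<Longrightarrow> norm (w' \<epsilon> x) \<le> norm (w \<epsilon> x)"
  show "\<forall>\<^sub>F \<epsilon> in at_right 0. \<forall>x\<in>K. norm (w' \<epsilon> x) \<le> C * \<epsilon> powr r"
    using C eventually_01 by eventually_elim (use le order_trans in blast)
qed

lemma unif_bound_add:
  assumes "unif_bound K r v" "unif_bound K r w"
  shows "unif_bound K r (\<lambda>\<epsilon> x. v \<epsilon> x + w \<epsilon> x)"
proof -
  obtain C where C: "\<forall>\<^sub>F \<epsilon> in at_right 0. \<forall>x\<in>K. norm (v \<epsilon> x) \<le> C * \<epsilon> powr r"
    using unif_boundE[OF assms(1)] .
  obtain D where D: "\<forall>\<^sub>F \<epsilon> in at_right 0. \<forall>x\<in>K. norm (w \<epsilon> x) \<le> D * \<epsilon> powr r"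
    using unif_boundE[OF assms(2)] .
  have "\<forall>\<^sub>F \<epsilon> in at_right 0. \<forall>x\<in>K. norm (v \<epsilon> x + w \<epsilon> x) \<le> (C + D) * \<epsilon> powr r"
    using C D by eventually_elim (auto simp: distrib_right intro!: norm_triangle_le add_mono)
  then show ?thesis unfolding unif_bound_def by blast
qed

lemma unif_bound_mult:
  assumes "unif_bound K r v" "unif_bound K s w"
  shows "unif_bound K (r + s) (\<lambda>\<epsilon> x. v \<epsilon> x * w \<epsilon> x)"
proof -
  obtain C where C: "C \<ge> 0" "\<forall>\<^sub>F \<epsilon> in at_right 0. \<forall>x\<in>K. norm (v \<epsilon> x) \<le> C * \<epsilon> powr r"
    using unif_boundE[OF assms(1)] .
  obtain D where D: "\<forall>\<^sub>F \<epsilon> in at_right 0. \<forall>x\<in>K. norm (w \<epsilon> x) \<le> D * \<epsilon> powr s"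
    using unif_boundE[OF assms(2)] .
  have "\<forall>\<^sub>F \<epsilon> in at_right 0. \<forall>x\<in>K. norm (v \<epsilon> x * w \<epsilon> x) \<le> (C * D) * \<epsilon> powr (r + s)"
    using C(2) D
  proof eventually_elim
    case (elim \<epsilon>)
    show ?case
    proof
      fix x assume "x \<in> K"
      then have "norm (v \<epsilon> x) * norm (w \<epsilon> x) \<le> (C * \<epsilon> powr r) * (D * \<epsilon> powr s)"
        using elim C(1) by (intro mult_mono) auto
      then show "norm (v \<epsilon> x * w \<epsilon> x) \<le> (C * D) * \<epsilon> powr (r + s)"
        by (simp add: norm_mult powr_add mult_ac)
    qed
  qed
  then show ?thesis unfolding unif_bound_def by blast
qed

lemma unif_mod_nat: "unif_mod K w \<longleftrightarrow> (\<exists>N::nat. unif_bound K (- real N) w)"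
proof
  assume "unif_mod K w"
  then obtain r where r: "unif_bound K r w" unfolding unif_mod_def by blast
  obtain N :: nat where "- r \<le> real N" using real_arch_simple by blast
  then show "\<exists>N::nat. unif_bound K (- real N) w" by (intro exI[of _ N] unif_bound_mono[OF r]) auto
qed (auto simp: unif_mod_def)

lemma unif_neg_nat: "unif_neg K w \<longleftrightarrow> (\<forall>q::nat. unif_bound K (real q) w)"
  unfolding unif_neg_def by (metis real_arch_simple unif_bound_mono)

lemma unif_neg_imp_mod: "unif_neg K w \<Longrightarrow> unif_mod K w"
  by (auto simp: unif_neg_def unif_mod_def)

lemma unif_mod_const: "unif_mod K (\<lambda>\<epsilon> x. c)"
  unfolding unif_mod_def unif_bound_def
  by (rule exI[of _ 0], rule exI[of _ "norm c"], rule eventually_mono[OF eventually_01]) auto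

lemma unif_neg_zero: "unif_neg K (\<lambda>\<epsilon> x. 0)"
  unfolding unif_neg_def unif_bound_def by (auto intro!: exI[of _ 0])

lemma unif_mod_add:
  assumes "unif_mod K v" "unif_mod K w" shows "unif_mod K (\<lambda>\<epsilon> x. v \<epsilon> x + w \<epsilon> x)"
proof -
  obtain r s where "unif_bound K r v" "unif_bound K s w" using assms unfolding unif_mod_def by blast
  then have "unif_bound K (min r s) v" "unif_bound K (min r s) w"
    using unif_bound_mono by (metis min.cobounded1, metis min.cobounded2)
  then show ?thesis unfolding unif_mod_def using unif_bound_add by blast
qed

lemma unif_mod_mult: "unif_mod K v \<Longrightarrow> unif_mod K w \<Longrightarrow> unif_mod K (\<lambda>\<epsilon> x. v \<epsilon> x * w \<epsilon> x)"
  unfolding unif_mod_def using unif_bound_mult by blast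

lemma unif_mod_cong:
  "unif_mod K w \<Longrightarrow> (\<And>\<epsilon> x. \<epsilon> \<in> {0<..1} \<Longrightarrow> x \<in> K \<Longrightarrow> norm (w' \<epsilon> x) \<le> norm (w \<epsilon> x)) \<Longrightarrow> unif_mod K w'"
  unfolding unif_mod_def by (elim exE, rule exI, rule unif_bound_cong)

lemma unif_neg_cong:
  "unif_neg K w \<Longrightarrow> (\<And>\<epsilon> x. \<epsilon> \<in> {0<..1} \<Longrightarrow> x \<in> K \<Longrightarrow> norm (w' \<epsilon> x) \<le> norm (w \<epsilon> x)) \<Longrightarrow> unif_neg K w'"
  unfolding unif_neg_def using unif_bound_cong by blast

lemma unif_neg_add: "unif_neg K v \<Longrightarrow> unif_neg K w \<Longrightarrow> unif_neg K (\<lambda>\<epsilon> x. v \<epsilon> x + w \<epsilon> x)"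
  unfolding unif_neg_def using unif_bound_add by blast

lemma unif_neg_mult:
  assumes "unif_mod K v" "unif_neg K w" shows "unif_neg K (\<lambda>\<epsilon> x. v \<epsilon> x * w \<epsilon> x)"
proof -
  obtain r where r: "unif_bound K r v" using assms(1) unfolding unif_mod_def by blast
  show ?thesis unfolding unif_neg_def
  proof
    fix s
    have "unif_bound K (s - r) w" using assms(2) by (simp add: unif_neg_def)
    from unif_bound_mult[OF r this] show "unif_bound K s (\<lambda>\<epsilon> x. v \<epsilon> x * w \<epsilon> x)" by simp
  qed
qed

lemma unif_neg_mult': "unif_neg K v \<Longrightarrow> unif_mod K w \<Longrightarrow> unif_neg K (\<lambda>\<epsilon> x. v \<epsilon> x * w \<epsilon> x)"
  using unif_neg_mult[of K w v] by (simp add: mult.commute)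

lemma unif_mod_sum:
  "(\<And>a. a \<in> A \<Longrightarrow> unif_mod K (f a)) \<Longrightarrow> unif_mod K (\<lambda>\<epsilon> x. \<Sum>a\<in>A. f a \<epsilon> x)"
  by (induction A rule: infinite_finite_induct) (auto intro: unif_mod_add unif_mod_const)

lemma unif_neg_sum:
  "(\<And>a. a \<in> A \<Longrightarrow> unif_neg K (f a)) \<Longrightarrow> unif_neg K (\<lambda>\<epsilon> x. \<Sum>a\<in>A. f a \<epsilon> x)"
  by (induction A rule: infinite_finite_induct) (auto intro: unif_neg_add unif_neg_zero)

lemma unif_mod_norm: "unif_mod K w \<Longrightarrow> unif_mod K (\<lambda>\<epsilon> x. norm (w \<epsilon> x))"
  by (simp add: unif_mod_def unif_bound_def)

lemma unif_neg_norm: "unif_neg K w \<Longrightarrow> unif_neg K (\<lambda>\<epsilon> x. norm (w \<epsilon> x))"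
  by (simp add: unif_neg_def unif_bound_def)

lemma bigo_iff_unif_bound:
  "(\<lambda>\<epsilon>. norm (u \<epsilon>)) \<in> O[at_right 0](\<lambda>\<epsilon>. \<epsilon> powr r) \<longleftrightarrow> unif_bound {()} r (\<lambda>\<epsilon> _. u \<epsilon>)"
proof
  assume "(\<lambda>\<epsilon>. norm (u \<epsilon>)) \<in> O[at_right 0](\<lambda>\<epsilon>. \<epsilon> powr r)"
  then show "unif_bound {()} r (\<lambda>\<epsilon> _. u \<epsilon>)"
    by (elim landau_o.bigE) (auto simp: unif_bound_def)
next
  assume "unif_bound {()} r (\<lambda>\<epsilon> _. u \<epsilon>)"
  then show "(\<lambda>\<epsilon>. norm (u \<epsilon>)) \<in> O[at_right 0](\<lambda>\<epsilon>. \<epsilon> powr r)"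
    unfolding unif_bound_def by (elim exE) (rule bigoI, simp)
qed

lemma moderate_num_iff: "moderate_num u \<longleftrightarrow> unif_mod {()} (\<lambda>\<epsilon> _. u \<epsilon>)"
  by (simp add: moderate_num_def unif_mod_nat bigo_iff_unif_bound)

lemma negligible_num_iff: "negligible_num u \<longleftrightarrow> unif_neg {()} (\<lambda>\<epsilon> _. u \<epsilon>)"
  by (simp add: negligible_num_def unif_neg_nat bigo_iff_unif_bound)

lemma moderate_num_const [simp]: "moderate_num (\<lambda>\<epsilon>. c)"
  by (simp add: moderate_num_iff unif_mod_const)

lemma moderate_num_add [simp]:
  "moderate_num u \<Longrightarrow> moderate_num v \<Longrightarrow> moderate_num (\<lambda>\<epsilon>. u \<epsilon> + v \<epsilon>)"
  by (simp add: moderate_num_iff unif_mod_add)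

lemma moderate_num_mult [simp]:
  "moderate_num u \<Longrightarrow> moderate_num v \<Longrightarrow> moderate_num (\<lambda>\<epsilon>. u \<epsilon> * v \<epsilon>)"
  by (simp add: moderate_num_iff unif_mod_mult)

lemma moderate_num_uminus [simp]: "moderate_num u \<Longrightarrow> moderate_num (\<lambda>\<epsilon>. - u \<epsilon>)"
  unfolding moderate_num_iff by (elim unif_mod_cong) auto

lemma moderate_num_diff [simp]:
  "moderate_num u \<Longrightarrow> moderate_num v \<Longrightarrow> moderate_num (\<lambda>\<epsilon>. u \<epsilon> - v \<epsilon>)"
  using moderate_num_add[OF _ moderate_num_uminus, of u v] by simp

lemma negligible_num_zero [simp]: "negligible_num (\<lambda>\<epsilon>. 0)"
  by (simp add: negligible_num_iff unif_neg_zero)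

lemma negligible_num_add:
  "negligible_num u \<Longrightarrow> negligible_num v \<Longrightarrow> negligible_num (\<lambda>\<epsilon>. u \<epsilon> + v \<epsilon>)"
  by (simp add: negligible_num_iff unif_neg_add)

lemma negligible_num_uminus: "negligible_num u \<Longrightarrow> negligible_num (\<lambda>\<epsilon>. - u \<epsilon>)"
  unfolding negligible_num_iff by (elim unif_neg_cong) auto

lemma negligible_num_mult:
  "moderate_num u \<Longrightarrow> negligible_num v \<Longrightarrow> negligible_num (\<lambda>\<epsilon>. u \<epsilon> * v \<epsilon>)"
  "negligible_num u \<Longrightarrow> moderate_num v \<Longrightarrow> negligible_num (\<lambda>\<epsilon>. u \<epsilon> * v \<epsilon>)"
  by (simp_all add: moderate_num_iff negligible_num_iff unif_neg_mult unif_neg_mult')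

lemma part_equivp_gen_num_rel:
  "part_equivp (gen_num_rel :: (real \<Rightarrow> 'a::real_normed_field) \<Rightarrow> _)"
proof (rule part_equivpI)
  show "\<exists>x :: real \<Rightarrow> 'a. gen_num_rel x x"
    by (rule exI[of _ "\<lambda>\<epsilon>. 0"]) (auto simp: gen_num_rel_def)
  show "symp (gen_num_rel :: (real \<Rightarrow> 'a) \<Rightarrow> _)"
  proof (rule sympI)
    fix u v :: "real \<Rightarrow> 'a" assume a: "gen_num_rel u v"
    then have "negligible_num (\<lambda>\<epsilon>. - (u \<epsilon> - v \<epsilon>))"
      unfolding gen_num_rel_def by (intro negligible_num_uminus) simp
    with a show "gen_num_rel v u" by (auto simp: gen_num_rel_def)
  qed
  show "transp (gen_num_rel :: (real \<Rightarrow> 'a) \<Rightarrow> _)"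
  proof (rule transpI)
    fix u v w :: "real \<Rightarrow> 'a" assume a: "gen_num_rel u v" "gen_num_rel v w"
    then have "negligible_num (\<lambda>\<epsilon>. (u \<epsilon> - v \<epsilon>) + (v \<epsilon> - w \<epsilon>))"
      unfolding gen_num_rel_def by (intro negligible_num_add) simp_all
    with a show "gen_num_rel u w" by (auto simp: gen_num_rel_def)
  qed
qed

text \<open>\<open>complex gen_num\<close> and \<open>real gen_num\<close> are the rings of complex and real generalized numbers.\<close>

quotient_type (overloaded) 'a gen_num = "real \<Rightarrow> 'a::real_normed_field" / partial: gen_num_rel
  by (rule part_equivp_gen_num_rel)

instantiation gen_num :: (real_normed_field) comm_ring_1
begin

lift_definition zero_gen_num :: "'a gen_num" is "\<lambda>\<epsilon>. 0"
  by (auto simp: gen_num_rel_def)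

lift_definition one_gen_num :: "'a gen_num" is "\<lambda>\<epsilon>. 1"
  by (auto simp: gen_num_rel_def)

lift_definition plus_gen_num :: "'a gen_num \<Rightarrow> 'a gen_num \<Rightarrow> 'a gen_num" is "\<lambda>u v \<epsilon>. u \<epsilon> + v \<epsilon>"
proof -
  fix u u' v v' :: "real \<Rightarrow> 'a" assume a: "gen_num_rel u u'" "gen_num_rel v v'"
  then have "negligible_num (\<lambda>\<epsilon>. (u \<epsilon> - u' \<epsilon>) + (v \<epsilon> - v' \<epsilon>))"
    unfolding gen_num_rel_def by (intro negligible_num_add) simp_all
  with a show "gen_num_rel (\<lambda>\<epsilon>. u \<epsilon> + v \<epsilon>) (\<lambda>\<epsilon>. u' \<epsilon> + v' \<epsilon>)"
    by (auto simp: gen_num_rel_def algebra_simps)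
qed

lift_definition uminus_gen_num :: "'a gen_num \<Rightarrow> 'a gen_num" is "\<lambda>u \<epsilon>. - u \<epsilon>"
proof -
  fix u u' :: "real \<Rightarrow> 'a" assume a: "gen_num_rel u u'"
  then have "negligible_num (\<lambda>\<epsilon>. - (u \<epsilon> - u' \<epsilon>))"
    unfolding gen_num_rel_def by (intro negligible_num_uminus) simp
  with a show "gen_num_rel (\<lambda>\<epsilon>. - u \<epsilon>) (\<lambda>\<epsilon>. - u' \<epsilon>)"
    by (auto simp: gen_num_rel_def algebra_simps)
qed

definition minus_gen_num :: "'a gen_num \<Rightarrow> 'a gen_num \<Rightarrow> 'a gen_num" where
  "minus_gen_num x y = x + - y"

lift_definition times_gen_num :: "'a gen_num \<Rightarrow> 'a gen_num \<Rightarrow> 'a gen_num" is "\<lambda>u v \<epsilon>. u \<epsilon> * v \<epsilon>"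
proof -
  fix u u' v v' :: "real \<Rightarrow> 'a" assume a: "gen_num_rel u u'" "gen_num_rel v v'"
  then have "negligible_num (\<lambda>\<epsilon>. u \<epsilon> * (v \<epsilon> - v' \<epsilon>) + (u \<epsilon> - u' \<epsilon>) * v' \<epsilon>)"
    unfolding gen_num_rel_def by (intro negligible_num_add) (simp_all add: negligible_num_mult)
  with a show "gen_num_rel (\<lambda>\<epsilon>. u \<epsilon> * v \<epsilon>) (\<lambda>\<epsilon>. u' \<epsilon> * v' \<epsilon>)"
    by (auto simp: gen_num_rel_def algebra_simps)
qed

instance
proof
  have "\<not> negligible_num (\<lambda>\<epsilon>. 1 :: 'a)"
  proof
    assume "negligible_num (\<lambda>\<epsilon>. 1 :: 'a)"
    then have "(\<lambda>\<epsilon>. norm (1::'a)) \<in> O[at_right 0](\<lambda>\<epsilon>. \<epsilon> powr real 1)"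
      unfolding negligible_num_def by blast
    then obtain C where C: "C > 0" "\<forall>\<^sub>F \<epsilon>::real in at_right 0. 1 \<le> C * \<bar>\<epsilon>\<bar>"
      by (elim landau_o.bigE) auto
    have "\<forall>\<^sub>F \<epsilon> in at_right 0. \<epsilon> < 1 / C"
      unfolding eventually_at_right_field using C by (intro exI[of _ "1 / C"]) auto
    with C(2) eventually_01 have "\<forall>\<^sub>F \<epsilon>::real in at_right 0. False"
      by eventually_elim (use C(1) in \<open>auto simp: field_simps\<close>)
    then show False by (simp add: trivial_limit_at_right_real)
  qed
  then show "(0 :: 'a gen_num) \<noteq> 1"
    by transfer (auto simp: gen_num_rel_def dest: negligible_num_uminus)
qed (unfold minus_gen_num_def, (transfer, auto simp: gen_num_rel_def algebra_simps)+)

end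

definition represents_num :: "(real \<Rightarrow> 'a::real_normed_field) \<Rightarrow> 'a gen_num \<Rightarrow> bool" where
  "represents_num u x \<longleftrightarrow> moderate_num u \<and> abs_gen_num u = x"


section \<open>The Colombeau algebra on \<open>\<real>\<^sup>n\<close>\<close>

text \<open>\<open>K \<noteq> {}\<close> is required because the supremum of the empty set of reals is unspecified.\<close>

definition moderate_fun :: "(real \<Rightarrow> real^'n::finite \<Rightarrow> complex) \<Rightarrow> bool" where
  "moderate_fun u \<longleftrightarrow> (\<forall>\<epsilon>\<in>{0<..1}. smooth (u \<epsilon>)) \<and>
    (\<forall>K \<alpha>. compact K \<and> K \<noteq> {} \<longrightarrow> (\<exists>N::nat.
      (\<lambda>\<epsilon>. SUP x\<in>K. cmod (mderiv \<alpha> (u \<epsilon>) x)) \<in> O[at_right 0](\<lambda>\<epsilon>. \<epsilon> powr - real N)))"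

definition negligible_fun :: "(real \<Rightarrow> real^'n::finite \<Rightarrow> complex) \<Rightarrow> bool" where
  "negligible_fun u \<longleftrightarrow> (\<forall>K \<alpha>. compact K \<and> K \<noteq> {} \<longrightarrow> (\<forall>q::nat.
      (\<lambda>\<epsilon>. SUP x\<in>K. cmod (mderiv \<alpha> (u \<epsilon>) x)) \<in> O[at_right 0](\<lambda>\<epsilon>. \<epsilon> powr real q)))"

definition colombeau_rel ::
    "(real \<Rightarrow> real^'n::finite \<Rightarrow> complex) \<Rightarrow> (real \<Rightarrow> real^'n \<Rightarrow> complex) \<Rightarrow> bool" where
  "colombeau_rel u v \<longleftrightarrow>
    moderate_fun u \<and> moderate_fun v \<and> negligible_fun (\<lambda>\<epsilon> x. u \<epsilon> x - v \<epsilon> x)"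

lemma sup_bigo_iff_unif_bound:
  fixes w :: "real \<Rightarrow> real^'n::finite \<Rightarrow> complex"
  assumes "compact K" "K \<noteq> {}" "\<And>\<epsilon>. \<epsilon> \<in> {0<..1} \<Longrightarrow> continuous_on K (w \<epsilon>)"
  shows "(\<lambda>\<epsilon>. SUP x\<in>K. cmod (w \<epsilon> x)) \<in> O[at_right 0](\<lambda>\<epsilon>. \<epsilon> powr r) \<longleftrightarrow> unif_bound K r w"
proof -
  have bdd: "bdd_above ((\<lambda>x. cmod (w \<epsilon> x)) ` K)" if "\<epsilon> \<in> {0<..1}" for \<epsilon>
    using assms that
    by (intro bounded_imp_bdd_above compact_imp_bounded compact_continuous_image continuous_on_norm) auto
  obtain y where y: "y \<in> K" using assms(2) by blast
  show ?thesis
  proof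
    assume "(\<lambda>\<epsilon>. SUP x\<in>K. cmod (w \<epsilon> x)) \<in> O[at_right 0](\<lambda>\<epsilon>. \<epsilon> powr r)"
    then obtain C where C: "\<forall>\<^sub>F \<epsilon> in at_right 0. norm (SUP x\<in>K. cmod (w \<epsilon> x)) \<le> C * norm (\<epsilon> powr r)"
      by (rule landau_o.bigE)
    have "\<forall>\<^sub>F \<epsilon> in at_right 0. \<forall>x\<in>K. cmod (w \<epsilon> x) \<le> C * \<epsilon> powr r"
      using C eventually_01
    proof eventually_elim
      case (elim \<epsilon>)
      show ?case
      proof
        fix x assume "x \<in> K"
        then have "cmod (w \<epsilon> x) \<le> (SUP x\<in>K. cmod (w \<epsilon> x))"
          using bdd[OF elim(2)] by (rule cSUP_upper)
        also have "\<dots> \<le> C * \<epsilon> powr r" using elim(1) by auto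
        finally show "cmod (w \<epsilon> x) \<le> C * \<epsilon> powr r" .
      qed
    qed
    then show "unif_bound K r w" unfolding unif_bound_def by blast
  next
    assume "unif_bound K r w"
    then obtain C where C: "\<forall>\<^sub>F \<epsilon> in at_right 0. \<forall>x\<in>K. cmod (w \<epsilon> x) \<le> C * \<epsilon> powr r"
      by (rule unif_boundE)
    have "\<forall>\<^sub>F \<epsilon> in at_right 0. norm (SUP x\<in>K. cmod (w \<epsilon> x)) \<le> C * norm (\<epsilon> powr r)"
      using C eventually_01
    proof eventually_elim
      case (elim \<epsilon>)
      have "0 \<le> cmod (w \<epsilon> y)" by simp
      also have "\<dots> \<le> (SUP x\<in>K. cmod (w \<epsilon> x))" using y bdd[OF elim(2)] by (rule cSUP_upper)
      finally have "0 \<le> (SUP x\<in>K. cmod (w \<epsilon> x))" .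
      moreover have "(SUP x\<in>K. cmod (w \<epsilon> x)) \<le> C * \<epsilon> powr r"
        using assms(2) elim(1) by (intro cSUP_least) auto
      ultimately show ?case by simp
    qed
    then show "(\<lambda>\<epsilon>. SUP x\<in>K. cmod (w \<epsilon> x)) \<in> O[at_right 0](\<lambda>\<epsilon>. \<epsilon> powr r)"
      by (rule bigoI)
  qed
qed

lemma mderiv_foldrE:
  obtains "is" where "\<And>f. smooth f \<Longrightarrow> mderiv \<alpha> f = foldr pderiv_at is f"
  using ex_count_list[of \<alpha>] mderiv_eq by metis

lemma foldr_mderiv: "smooth f \<Longrightarrow> foldr pderiv_at is f = mderiv (count_list is) f"
  using mderiv_eq by metis

lemma all_mderiv_iff:
  assumes "\<And>\<epsilon>. \<epsilon> \<in> {0<..1} \<Longrightarrow> smooth (u \<epsilon>)"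
  shows "(\<forall>\<alpha>. unif_mod K (\<lambda>\<epsilon>. mderiv \<alpha> (u \<epsilon>))) \<longleftrightarrow> (\<forall>is. unif_mod K (\<lambda>\<epsilon>. foldr pderiv_at is (u \<epsilon>)))"
    and "(\<forall>\<alpha>. unif_neg K (\<lambda>\<epsilon>. mderiv \<alpha> (u \<epsilon>))) \<longleftrightarrow> (\<forall>is. unif_neg K (\<lambda>\<epsilon>. foldr pderiv_at is (u \<epsilon>)))"
proof -
  have 1: "\<exists>is. \<forall>\<epsilon>\<in>{0<..1}. mderiv \<alpha> (u \<epsilon>) = foldr pderiv_at is (u \<epsilon>)" for \<alpha>
    using assms by (metis mderiv_foldrE)
  have 2: "\<forall>\<epsilon>\<in>{0<..1}. foldr pderiv_at is (u \<epsilon>) = mderiv (count_list is) (u \<epsilon>)" for "is"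
    using assms foldr_mderiv by blast
  have c: "unif_mod K v \<longleftrightarrow> unif_mod K w" "unif_neg K v \<longleftrightarrow> unif_neg K w"
    if "\<forall>\<epsilon>\<in>{0<..1}. v \<epsilon> = w \<epsilon>" for v w :: "real \<Rightarrow> real^'a \<Rightarrow> complex"
    using that unif_mod_cong[of K v w] unif_mod_cong[of K w v]
      unif_neg_cong[of K v w] unif_neg_cong[of K w v] by auto
  show "(\<forall>\<alpha>. unif_mod K (\<lambda>\<epsilon>. mderiv \<alpha> (u \<epsilon>))) \<longleftrightarrow> (\<forall>is. unif_mod K (\<lambda>\<epsilon>. foldr pderiv_at is (u \<epsilon>)))"
    "(\<forall>\<alpha>. unif_neg K (\<lambda>\<epsilon>. mderiv \<alpha> (u \<epsilon>))) \<longleftrightarrow> (\<forall>is. unif_neg K (\<lambda>\<epsilon>. foldr pderiv_at is (u \<epsilon>)))"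
    using c[OF 2] 1 c by metis+
qed

lemma smooth_mderiv: "smooth f \<Longrightarrow> smooth (mderiv \<alpha> f)"
  unfolding mderiv_def by (rule smooth_foldr)

lemma sup_mderiv_bigo_iff:
  assumes "compact K \<and> K \<noteq> {}" "\<forall>\<epsilon>\<in>{0<..1}. smooth (u \<epsilon>)"
  shows "(\<lambda>\<epsilon>. SUP x\<in>K. cmod (mderiv \<alpha> (u \<epsilon>) x)) \<in> O[at_right 0](\<lambda>\<epsilon>. \<epsilon> powr r) \<longleftrightarrow>
    unif_bound K r (\<lambda>\<epsilon>. mderiv \<alpha> (u \<epsilon>))"
  using assms by (intro sup_bigo_iff_unif_bound smooth_continuous smooth_mderiv) auto

lemma moderate_fun_iff:
  "moderate_fun u \<longleftrightarrow> (\<forall>\<epsilon>\<in>{0<..1}. smooth (u \<epsilon>)) \<and>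
    (\<forall>K is. compact K \<and> K \<noteq> {} \<longrightarrow> unif_mod K (\<lambda>\<epsilon>. foldr pderiv_at is (u \<epsilon>)))"
proof (cases "\<forall>\<epsilon>\<in>{0<..1}. smooth (u \<epsilon>)")
  case True
  then have "moderate_fun u \<longleftrightarrow> (\<forall>K \<alpha>. compact K \<and> K \<noteq> {} \<longrightarrow> unif_mod K (\<lambda>\<epsilon>. mderiv \<alpha> (u \<epsilon>)))"
    unfolding moderate_fun_def unif_mod_nat using sup_mderiv_bigo_iff[of _ u] by blast
  then show ?thesis using True all_mderiv_iff(1)[of u] by blast
qed (auto simp: moderate_fun_def)

lemma negligible_fun_iff:
  assumes "\<And>\<epsilon>. \<epsilon> \<in> {0<..1} \<Longrightarrow> smooth (u \<epsilon>)"
  shows "negligible_fun u \<longleftrightarrow>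
    (\<forall>K is. compact K \<and> K \<noteq> {} \<longrightarrow> unif_neg K (\<lambda>\<epsilon>. foldr pderiv_at is (u \<epsilon>)))"
proof -
  have "negligible_fun u \<longleftrightarrow> (\<forall>K \<alpha>. compact K \<and> K \<noteq> {} \<longrightarrow> unif_neg K (\<lambda>\<epsilon>. mderiv \<alpha> (u \<epsilon>)))"
    unfolding negligible_fun_def unif_neg_nat using sup_mderiv_bigo_iff[of _ u] assms by blast
  then show ?thesis using assms all_mderiv_iff(2)[of u] by blast
qed

definition null_fun :: "(real \<Rightarrow> real^'n::finite \<Rightarrow> complex) \<Rightarrow> bool" where
  "null_fun u \<longleftrightarrow> (\<forall>\<epsilon>\<in>{0<..1}. smooth (u \<epsilon>)) \<and>
    (\<forall>K is. compact K \<and> K \<noteq> {} \<longrightarrow> unif_neg K (\<lambda>\<epsilon>. foldr pderiv_at is (u \<epsilon>)))"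

lemma colombeau_rel_iff:
  "colombeau_rel u v \<longleftrightarrow> moderate_fun u \<and> moderate_fun v \<and> null_fun (\<lambda>\<epsilon> x. u \<epsilon> x - v \<epsilon> x)"
proof -
  have "smooth (\<lambda>x. u \<epsilon> x - v \<epsilon> x)" if "moderate_fun u" "moderate_fun v" "\<epsilon> \<in> {0<..1}" for \<epsilon>
    using that by (intro smooth_diff) (auto simp: moderate_fun_def)
  then show ?thesis
    unfolding colombeau_rel_def null_fun_def using negligible_fun_iff[of "\<lambda>\<epsilon> x. u \<epsilon> x - v \<epsilon> x"]
    by auto
qed

lemma moderate_fun_pderiv: "moderate_fun u \<Longrightarrow> moderate_fun (\<lambda>\<epsilon>. pderiv_at i (u \<epsilon>))"
  unfolding moderate_fun_iff
proof (intro conjI allI impI ballI; elim conjE)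
  fix K :: "(real^'a) set" and "is" :: "'a list" assume "\<forall>K is. compact K \<and> K \<noteq> {} \<longrightarrow> unif_mod K (\<lambda>\<epsilon>. foldr pderiv_at is (u \<epsilon>))"
    "compact K" "K \<noteq> {}"
  then have "unif_mod K (\<lambda>\<epsilon>. foldr pderiv_at (is @ [i]) (u \<epsilon>))" by blast
  then show "unif_mod K (\<lambda>\<epsilon>. foldr pderiv_at is (pderiv_at i (u \<epsilon>)))" by simp
qed (auto intro: smooth_pderiv)

lemma null_fun_pderiv: "null_fun u \<Longrightarrow> null_fun (\<lambda>\<epsilon>. pderiv_at i (u \<epsilon>))"
  unfolding null_fun_def
proof (intro conjI allI impI ballI; elim conjE)
  fix K :: "(real^'a) set" and "is" :: "'a list" assume "\<forall>K is. compact K \<and> K \<noteq> {} \<longrightarrow> unif_neg K (\<lambda>\<epsilon>. foldr pderiv_at is (u \<epsilon>))"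
    "compact K" "K \<noteq> {}"
  then have "unif_neg K (\<lambda>\<epsilon>. foldr pderiv_at (is @ [i]) (u \<epsilon>))" by blast
  then show "unif_neg K (\<lambda>\<epsilon>. foldr pderiv_at is (pderiv_at i (u \<epsilon>)))" by simp
qed (auto intro: smooth_pderiv)

lemma foldr_pderiv_mult_step:
  assumes "smooth f" "smooth g"
  shows "foldr pderiv_at (is @ [i]) (\<lambda>x. f x * g x) =
    (\<lambda>x. foldr pderiv_at is (\<lambda>x. f x * pderiv_at i g x) x + foldr pderiv_at is (\<lambda>x. pderiv_at i f x * g x) x)"
proof -
  have "pderiv_at i (\<lambda>x. f x * g x) = (\<lambda>x. f x * pderiv_at i g x + pderiv_at i f x * g x)"
    by (rule ext, rule pderiv_mult) (use assms smooth_differentiable in auto)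
  then show ?thesis
    using foldr_pderiv_add[OF smooth_mult[OF assms(1) smooth_pderiv[OF assms(2)]]
        smooth_mult[OF smooth_pderiv[OF assms(1)] assms(2)]]
    by simp
qed

lemma moderate_fun_mult:
  assumes "moderate_fun u" "moderate_fun v"
  shows "moderate_fun (\<lambda>\<epsilon> x. u \<epsilon> x * v \<epsilon> x)"
proof -
  have "unif_mod K (\<lambda>\<epsilon>. foldr pderiv_at is (\<lambda>x. u \<epsilon> x * v \<epsilon> x))" if K: "compact K" "K \<noteq> {}" for K "is"
    using assms
  proof (induction "is" arbitrary: u v rule: rev_induct)
    case Nil
    then have "unif_mod K (\<lambda>\<epsilon>. foldr pderiv_at [] (u \<epsilon>))" "unif_mod K (\<lambda>\<epsilon>. foldr pderiv_at [] (v \<epsilon>))"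
      using K unfolding moderate_fun_iff by blast+
    from unif_mod_mult[OF this] show ?case by simp
  next
    case (snoc i "is")
    have "unif_mod K (\<lambda>\<epsilon> x. foldr pderiv_at is (\<lambda>x. u \<epsilon> x * pderiv_at i (v \<epsilon>) x) x +
        foldr pderiv_at is (\<lambda>x. pderiv_at i (u \<epsilon>) x * v \<epsilon> x) x)"
      by (intro unif_mod_add snoc.IH snoc.prems moderate_fun_pderiv)
    then show ?case
    proof (rule unif_mod_cong)
      fix \<epsilon> :: real and x assume "\<epsilon> \<in> {0<..1}"
      then have "smooth (u \<epsilon>)" "smooth (v \<epsilon>)" using snoc.prems by (auto simp: moderate_fun_def)
      from foldr_pderiv_mult_step[OF this]
      show "cmod (foldr pderiv_at (is @ [i]) (\<lambda>x. u \<epsilon> x * v \<epsilon> x) x) \<le>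
        cmod (foldr pderiv_at is (\<lambda>x. u \<epsilon> x * pderiv_at i (v \<epsilon>) x) x +
        foldr pderiv_at is (\<lambda>x. pderiv_at i (u \<epsilon>) x * v \<epsilon> x) x)"
        by (simp only:)
    qed
  qed
  then show ?thesis using assms by (auto simp: moderate_fun_iff intro: smooth_mult)
qed

lemma null_fun_mult:
  assumes "moderate_fun u" "null_fun v"
  shows "null_fun (\<lambda>\<epsilon> x. u \<epsilon> x * v \<epsilon> x)"
proof -
  have "unif_neg K (\<lambda>\<epsilon>. foldr pderiv_at is (\<lambda>x. u \<epsilon> x * v \<epsilon> x))" if K: "compact K" "K \<noteq> {}" for K "is"
    using assms
  proof (induction "is" arbitrary: u v rule: rev_induct)
    case Nil
    then have "unif_mod K (\<lambda>\<epsilon>. foldr pderiv_at [] (u \<epsilon>))" "unif_neg K (\<lambda>\<epsilon>. foldr pderiv_at [] (v \<epsilon>))"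
      using K unfolding moderate_fun_iff null_fun_def by blast+
    from unif_neg_mult[OF this] show ?case by simp
  next
    case (snoc i "is")
    have "unif_neg K (\<lambda>\<epsilon> x. foldr pderiv_at is (\<lambda>x. u \<epsilon> x * pderiv_at i (v \<epsilon>) x) x +
        foldr pderiv_at is (\<lambda>x. pderiv_at i (u \<epsilon>) x * v \<epsilon> x) x)"
      by (intro unif_neg_add snoc.IH snoc.prems moderate_fun_pderiv null_fun_pderiv)
    then show ?case
    proof (rule unif_neg_cong)
      fix \<epsilon> :: real and x assume "\<epsilon> \<in> {0<..1}"
      then have "smooth (u \<epsilon>)" "smooth (v \<epsilon>)" using snoc.prems by (auto simp: moderate_fun_def null_fun_def)
      from foldr_pderiv_mult_step[OF this]
      show "cmod (foldr pderiv_at (is @ [i]) (\<lambda>x. u \<epsilon> x * v \<epsilon> x) x) \<le>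
        cmod (foldr pderiv_at is (\<lambda>x. u \<epsilon> x * pderiv_at i (v \<epsilon>) x) x +
        foldr pderiv_at is (\<lambda>x. pderiv_at i (u \<epsilon>) x * v \<epsilon> x) x)"
        by (simp only:)
    qed
  qed
  then show ?thesis using assms by (auto simp: moderate_fun_iff null_fun_def intro: smooth_mult)
qed

lemma null_fun_mult': "null_fun u \<Longrightarrow> moderate_fun v \<Longrightarrow> null_fun (\<lambda>\<epsilon> x. u \<epsilon> x * v \<epsilon> x)"
  using null_fun_mult[of v u] by (simp add: mult.commute)

lemma moderate_fun_add:
  assumes "moderate_fun u" "moderate_fun v" shows "moderate_fun (\<lambda>\<epsilon> x. u \<epsilon> x + v \<epsilon> x)"
  unfolding moderate_fun_iff
proof (intro conjI allI impI ballI)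
  fix K :: "(real^'a) set" and "is" :: "'a list" assume "compact K \<and> K \<noteq> {}"
  then have "unif_mod K (\<lambda>\<epsilon> x. foldr pderiv_at is (u \<epsilon>) x + foldr pderiv_at is (v \<epsilon>) x)"
    using assms by (intro unif_mod_add) (auto simp: moderate_fun_iff)
  then show "unif_mod K (\<lambda>\<epsilon>. foldr pderiv_at is (\<lambda>x. u \<epsilon> x + v \<epsilon> x))"
    by (rule unif_mod_cong) (use assms in \<open>simp add: foldr_pderiv_add moderate_fun_def\<close>)
qed (use assms in \<open>auto simp: moderate_fun_def intro: smooth_add\<close>)

lemma null_fun_add:
  assumes "null_fun u" "null_fun v" shows "null_fun (\<lambda>\<epsilon> x. u \<epsilon> x + v \<epsilon> x)"
  unfolding null_fun_def
proof (intro conjI allI impI ballI)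
  fix K :: "(real^'a) set" and "is" :: "'a list" assume "compact K \<and> K \<noteq> {}"
  then have "unif_neg K (\<lambda>\<epsilon> x. foldr pderiv_at is (u \<epsilon>) x + foldr pderiv_at is (v \<epsilon>) x)"
    using assms by (intro unif_neg_add) (auto simp: null_fun_def)
  then show "unif_neg K (\<lambda>\<epsilon>. foldr pderiv_at is (\<lambda>x. u \<epsilon> x + v \<epsilon> x))"
    by (rule unif_neg_cong) (use assms in \<open>simp add: foldr_pderiv_add null_fun_def\<close>)
qed (use assms in \<open>auto simp: null_fun_def intro: smooth_add\<close>)

lemma foldr_pderiv_const: "foldr pderiv_at is (\<lambda>x. c) = (\<lambda>x. if is = [] then c else 0)"
  by (induction "is") auto

lemma moderate_fun_const_num:
  assumes "moderate_num c" shows "moderate_fun (\<lambda>\<epsilon> x. c \<epsilon>)"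
  unfolding moderate_fun_iff
proof (intro conjI allI impI ballI)
  fix K :: "(real^'a) set" and "is" :: "'a list"
  have "unif_mod K (\<lambda>\<epsilon> x. c \<epsilon>)"
    using assms unfolding moderate_num_iff unif_mod_def by (blast intro: unif_bound_const_net)
  then show "unif_mod K (\<lambda>\<epsilon>. foldr pderiv_at is (\<lambda>x. c \<epsilon>))"
    by (rule unif_mod_cong) (simp add: foldr_pderiv_const)
qed auto

lemma null_fun_const_num:
  assumes "negligible_num c" shows "null_fun (\<lambda>\<epsilon> x. c \<epsilon>)"
  unfolding null_fun_def
proof (intro conjI allI impI ballI)
  fix K :: "(real^'a) set" and "is" :: "'a list"
  have "unif_neg K (\<lambda>\<epsilon> x. c \<epsilon>)"
    using assms unfolding negligible_num_iff unif_neg_def by (blast intro: unif_bound_const_net)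
  then show "unif_neg K (\<lambda>\<epsilon>. foldr pderiv_at is (\<lambda>x. c \<epsilon>))"
    by (rule unif_neg_cong) (simp add: foldr_pderiv_const)
qed auto

lemma moderate_fun_const [simp]: "moderate_fun (\<lambda>\<epsilon> x. c)"
  using moderate_fun_const_num[of "\<lambda>\<epsilon>. c"] by simp

lemma null_fun_zero [simp]: "null_fun (\<lambda>\<epsilon> x. 0)"
  using null_fun_const_num[of "\<lambda>\<epsilon>. 0"] by simp

lemma moderate_fun_uminus: "moderate_fun u \<Longrightarrow> moderate_fun (\<lambda>\<epsilon> x. - u \<epsilon> x)"
  using moderate_fun_mult[OF moderate_fun_const[of "-1"], of u] by simp

lemma moderate_fun_diff: "moderate_fun u \<Longrightarrow> moderate_fun v \<Longrightarrow> moderate_fun (\<lambda>\<epsilon> x. u \<epsilon> x - v \<epsilon> x)"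
  using moderate_fun_add[OF _ moderate_fun_uminus, of u v] by simp

lemma null_fun_uminus: "null_fun u \<Longrightarrow> null_fun (\<lambda>\<epsilon> x. - u \<epsilon> x)"
  using null_fun_mult[OF moderate_fun_const[of "-1"], of u] by simp

lemma part_equivp_colombeau_rel:
  "part_equivp (colombeau_rel :: (real \<Rightarrow> real^'n::finite \<Rightarrow> complex) \<Rightarrow> _)"
proof (rule part_equivpI)
  show "\<exists>x :: real \<Rightarrow> real^'n \<Rightarrow> complex. colombeau_rel x x"
    by (rule exI[of _ "\<lambda>\<epsilon> x. 0"]) (simp add: colombeau_rel_iff)
  show "symp (colombeau_rel :: (real \<Rightarrow> real^'n \<Rightarrow> complex) \<Rightarrow> _)"
  proof (rule sympI)
    fix u v :: "real \<Rightarrow> real^'n \<Rightarrow> complex" assume a: "colombeau_rel u v"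
    then have "null_fun (\<lambda>\<epsilon> x. - (u \<epsilon> x - v \<epsilon> x))"
      unfolding colombeau_rel_iff by (intro null_fun_uminus) simp
    with a show "colombeau_rel v u" by (simp add: colombeau_rel_iff)
  qed
  show "transp (colombeau_rel :: (real \<Rightarrow> real^'n \<Rightarrow> complex) \<Rightarrow> _)"
  proof (rule transpI)
    fix u v w :: "real \<Rightarrow> real^'n \<Rightarrow> complex" assume a: "colombeau_rel u v" "colombeau_rel v w"
    then have "null_fun (\<lambda>\<epsilon> x. (u \<epsilon> x - v \<epsilon> x) + (v \<epsilon> x - w \<epsilon> x))"
      unfolding colombeau_rel_iff by (intro null_fun_add) simp_all
    with a show "colombeau_rel u w" by (simp add: colombeau_rel_iff)
  qed
qed

quotient_type (overloaded) 'n colombeau = "real \<Rightarrow> real^'n::finite \<Rightarrow> complex" / partial: colombeau_rel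
  by (rule part_equivp_colombeau_rel)

instantiation colombeau :: (finite) comm_ring_1
begin

lift_definition zero_colombeau :: "'a colombeau" is "\<lambda>\<epsilon> x. 0"
  by (simp add: colombeau_rel_iff)

lift_definition one_colombeau :: "'a colombeau" is "\<lambda>\<epsilon> x. 1"
  by (simp add: colombeau_rel_iff)

lift_definition plus_colombeau :: "'a colombeau \<Rightarrow> 'a colombeau \<Rightarrow> 'a colombeau"
  is "\<lambda>u v \<epsilon> x. u \<epsilon> x + v \<epsilon> x"
proof -
  fix u u' v v' :: "real \<Rightarrow> real^'a \<Rightarrow> complex"
  assume a: "colombeau_rel u u'" "colombeau_rel v v'"
  then have "null_fun (\<lambda>\<epsilon> x. (u \<epsilon> x - u' \<epsilon> x) + (v \<epsilon> x - v' \<epsilon> x))"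
    unfolding colombeau_rel_iff by (intro null_fun_add) simp_all
  with a show "colombeau_rel (\<lambda>\<epsilon> x. u \<epsilon> x + v \<epsilon> x) (\<lambda>\<epsilon> x. u' \<epsilon> x + v' \<epsilon> x)"
    by (auto simp: colombeau_rel_iff algebra_simps moderate_fun_add)
qed

lift_definition uminus_colombeau :: "'a colombeau \<Rightarrow> 'a colombeau" is "\<lambda>u \<epsilon> x. - u \<epsilon> x"
proof -
  fix u u' :: "real \<Rightarrow> real^'a \<Rightarrow> complex" assume a: "colombeau_rel u u'"
  then have "null_fun (\<lambda>\<epsilon> x. - (u \<epsilon> x - u' \<epsilon> x))"
    unfolding colombeau_rel_iff by (intro null_fun_uminus) simp
  with a show "colombeau_rel (\<lambda>\<epsilon> x. - u \<epsilon> x) (\<lambda>\<epsilon> x. - u' \<epsilon> x)"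
    by (auto simp: colombeau_rel_iff algebra_simps moderate_fun_uminus)
qed

definition minus_colombeau :: "'a colombeau \<Rightarrow> 'a colombeau \<Rightarrow> 'a colombeau" where
  "minus_colombeau u v = u + - v"

lift_definition times_colombeau :: "'a colombeau \<Rightarrow> 'a colombeau \<Rightarrow> 'a colombeau"
  is "\<lambda>u v \<epsilon> x. u \<epsilon> x * v \<epsilon> x"
proof -
  fix u u' v v' :: "real \<Rightarrow> real^'a \<Rightarrow> complex"
  assume a: "colombeau_rel u u'" "colombeau_rel v v'"
  then have "null_fun (\<lambda>\<epsilon> x. u \<epsilon> x * (v \<epsilon> x - v' \<epsilon> x) + (u \<epsilon> x - u' \<epsilon> x) * v' \<epsilon> x)"
    unfolding colombeau_rel_iff by (intro null_fun_add) (simp_all add: null_fun_mult null_fun_mult')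
  with a show "colombeau_rel (\<lambda>\<epsilon> x. u \<epsilon> x * v \<epsilon> x) (\<lambda>\<epsilon> x. u' \<epsilon> x * v' \<epsilon> x)"
    by (auto simp: colombeau_rel_iff algebra_simps moderate_fun_mult)
qed

lemma null_fun_point: 
  assumes "null_fun u" shows "negligible_num (\<lambda>\<epsilon>. u \<epsilon> x)"
proof -
  have "unif_neg {x} (\<lambda>\<epsilon>. foldr pderiv_at [] (u \<epsilon>))"
    using assms compact_sing unfolding null_fun_def by blast
  then show ?thesis by (simp add: negligible_num_iff unif_neg_def unif_bound_def)
qed

lemma moderate_fun_point: 
  assumes "moderate_fun u" shows "moderate_num (\<lambda>\<epsilon>. u \<epsilon> x)"
proof -
  have "unif_mod {x} (\<lambda>\<epsilon>. foldr pderiv_at [] (u \<epsilon>))"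
    using assms compact_sing unfolding moderate_fun_iff by blast
  then show ?thesis by (simp add: moderate_num_iff unif_mod_def unif_bound_def)
qed

instance
proof
  have "\<not> gen_num_rel (\<lambda>\<epsilon>. 0) (\<lambda>\<epsilon>. 1 :: complex)"
    using zero_neq_one[where 'a = "complex gen_num"] by transfer
  then have "\<not> negligible_num (\<lambda>\<epsilon>. - 1 :: complex)" by (simp add: gen_num_rel_def)
  then have "\<not> null_fun (\<lambda>\<epsilon> x :: real^'a. - 1)" using null_fun_point by blast
  then show "(0 :: 'a colombeau) \<noteq> 1"
    by transfer (simp add: colombeau_rel_iff)
qed (unfold minus_colombeau_def, (transfer, auto simp: colombeau_rel_iff algebra_simps
  moderate_fun_add moderate_fun_mult moderate_fun_uminus)+)

end

lift_definition point_value :: "'n::finite colombeau \<Rightarrow> real^'n \<Rightarrow> complex gen_num"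
  is "\<lambda>u x \<epsilon>. u \<epsilon> x"
  by (auto simp: colombeau_rel_iff gen_num_rel_def moderate_fun_point dest: null_fun_point)

lift_definition const_fun :: "complex gen_num \<Rightarrow> 'n::finite colombeau" is "\<lambda>c \<epsilon> x. c \<epsilon>"
  by (auto simp: colombeau_rel_iff gen_num_rel_def moderate_fun_const_num dest: null_fun_const_num)

section \<open>Differential operators\<close>

lemma moderate_fun_foldr: "moderate_fun u \<Longrightarrow> moderate_fun (\<lambda>\<epsilon>. foldr pderiv_at is (u \<epsilon>))"
  by (induction "is") (auto intro: moderate_fun_pderiv)

lemma null_fun_foldr: "null_fun u \<Longrightarrow> null_fun (\<lambda>\<epsilon>. foldr pderiv_at is (u \<epsilon>))"
  by (induction "is") (auto intro: null_fun_pderiv)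

lemma null_fun_cong:
  assumes "null_fun u" "\<And>\<epsilon>. \<epsilon> \<in> {0<..1} \<Longrightarrow> v \<epsilon> = u \<epsilon>"
  shows "null_fun v"
  unfolding null_fun_def
proof (intro conjI allI impI ballI)
  fix K :: "(real^'a) set" and "is" :: "'a list" assume "compact K \<and> K \<noteq> {}"
  then have "unif_neg K (\<lambda>\<epsilon>. foldr pderiv_at is (u \<epsilon>))" using assms(1) by (auto simp: null_fun_def)
  then show "unif_neg K (\<lambda>\<epsilon>. foldr pderiv_at is (v \<epsilon>))"
    by (rule unif_neg_cong) (use assms(2) in simp)
qed (use assms in \<open>auto simp: null_fun_def\<close>)

text \<open>\<open>D\<^sup>\<alpha> = (-i)\<^bsup>|\<alpha>|\<^esup> \<partial>\<^sup>\<alpha>\<close>.\<close>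

lift_definition D_op :: "('n::finite \<Rightarrow> nat) \<Rightarrow> 'n colombeau \<Rightarrow> 'n colombeau"
  is "\<lambda>\<alpha> u \<epsilon> x. (- \<i>) ^ mi_order \<alpha> * mderiv \<alpha> (u \<epsilon>) x"
proof -
  fix \<alpha> :: "'n \<Rightarrow> nat" and u v :: "real \<Rightarrow> real^'n \<Rightarrow> complex"
  assume a: "colombeau_rel u v"
  let ?c = "(- \<i>) ^ mi_order \<alpha>"
  have m: "moderate_fun (\<lambda>\<epsilon> x. ?c * mderiv \<alpha> (w \<epsilon>) x)" if "moderate_fun w" for w
    unfolding mderiv_def by (intro moderate_fun_mult moderate_fun_const moderate_fun_foldr that)
  have "null_fun (\<lambda>\<epsilon> x. ?c * mderiv \<alpha> (\<lambda>x. u \<epsilon> x - v \<epsilon> x) x)"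
    unfolding mderiv_def
    by (intro null_fun_mult moderate_fun_const null_fun_foldr) (use a in \<open>simp add: colombeau_rel_iff\<close>)
  then have "null_fun (\<lambda>\<epsilon> x. ?c * mderiv \<alpha> (u \<epsilon>) x - ?c * mderiv \<alpha> (v \<epsilon>) x)"
  proof (rule null_fun_cong)
    fix \<epsilon> :: real assume "\<epsilon> \<in> {0<..1}"
    then have "smooth (u \<epsilon>)" "smooth (v \<epsilon>)" using a by (auto simp: colombeau_rel_iff moderate_fun_def)
    then show "(\<lambda>x. ?c * mderiv \<alpha> (u \<epsilon>) x - ?c * mderiv \<alpha> (v \<epsilon>) x) =
        (\<lambda>x. ?c * mderiv \<alpha> (\<lambda>x. u \<epsilon> x - v \<epsilon> x) x)"
      unfolding mderiv_def by (simp add: foldr_pderiv_diff right_diff_distrib)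
  qed
  then show "colombeau_rel (\<lambda>\<epsilon> x. ?c * mderiv \<alpha> (u \<epsilon>) x) (\<lambda>\<epsilon> x. ?c * mderiv \<alpha> (v \<epsilon>) x)"
    using a m by (simp add: colombeau_rel_iff)
qed

text \<open>An operator of order at most \<open>m\<close> is given by \<open>m\<close> and its family of coefficients; only the
  coefficients of index \<open>|\<alpha>| \<le> m\<close> matter.\<close>

definition diff_op :: "nat \<Rightarrow> (('n::finite \<Rightarrow> nat) \<Rightarrow> 'n colombeau) \<Rightarrow> 'n colombeau \<Rightarrow> 'n colombeau" where
  "diff_op m c u = (\<Sum>\<alpha> | mi_order \<alpha> \<le> m. c \<alpha> * D_op \<alpha> u)"

definition const_diff_op ::
    "nat \<Rightarrow> (('n::finite \<Rightarrow> nat) \<Rightarrow> complex gen_num) \<Rightarrow> 'n colombeau \<Rightarrow> 'n colombeau" where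
  "const_diff_op m c = diff_op m (\<lambda>\<alpha>. const_fun (c \<alpha>))"

section \<open>Symbols\<close>

definition monomial :: "('n::finite \<Rightarrow> nat) \<Rightarrow> real^'n \<Rightarrow> complex" where
  "monomial \<alpha> \<xi> = of_real (\<Prod>i\<in>UNIV. (\<xi> $ i) ^ \<alpha> i)"

definition poly_fun :: "('n::finite \<Rightarrow> nat) set \<Rightarrow> (('n \<Rightarrow> nat) \<Rightarrow> complex) \<Rightarrow> real^'n \<Rightarrow> complex" where
  "poly_fun A a \<xi> = (\<Sum>\<alpha>\<in>A. a \<alpha> * monomial \<alpha> \<xi>)"

text \<open>\<open>(\<Sum>\<^sub>\<alpha> |\<partial>\<^sup>\<alpha> Q(\<xi>)|\<^sup>2)\<^bsup>1/2\<^esup>\<close>; for a polynomial \<open>Q\<close> only finitely many terms are nonzero.\<close>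

definition tilde :: "(real^'n::finite \<Rightarrow> complex) \<Rightarrow> real^'n \<Rightarrow> real" where
  "tilde Q \<xi> = sqrt (\<Sum>\<^sub>\<infinity>\<alpha>. (cmod (mderiv \<alpha> Q \<xi>))\<^sup>2)"

lemma finite_mi: "finite {\<alpha> :: 'n::finite \<Rightarrow> nat. mi_order \<alpha> \<le> m}"
proof (rule finite_subset)
  show "{\<alpha> :: 'n \<Rightarrow> nat. mi_order \<alpha> \<le> m} \<subseteq> (UNIV \<rightarrow>\<^sub>E {..m})"
  proof
    fix \<alpha> :: "'n \<Rightarrow> nat" assume "\<alpha> \<in> {\<alpha>. mi_order \<alpha> \<le> m}"
    moreover have "\<alpha> i \<le> mi_order \<alpha>" for i by (rule member_le_sum) auto
    ultimately show "\<alpha> \<in> UNIV \<rightarrow>\<^sub>E {..m}" using order_trans by (auto simp: PiE_UNIV_domain)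
  qed
qed (auto intro: finite_PiE)

lemma smooth_coord: "smooth (\<lambda>\<xi>. of_real (\<xi> $ i))"
proof -
  have d: "((\<lambda>\<xi>. of_real (\<xi> $ i) :: complex) has_derivative (\<lambda>h. of_real (h $ i))) (at \<xi>)" for \<xi>
    by (intro bounded_linear_imp_has_derivative bounded_linear_compose[OF bounded_linear_of_real]
        bounded_linear_vec_nth)
  have p: "pderiv_at j (\<lambda>\<xi>. of_real (\<xi> $ i)) = (\<lambda>\<xi>. of_real (axis j 1 $ i))" for j
    using pderiv_atI[OF d] by blast
  show ?thesis
    by (rule smooth_coinduct[where X = "\<lambda>f. f = (\<lambda>\<xi>. of_real (\<xi> $ i)) \<or> (\<exists>c. f = (\<lambda>x. c))"])
       (auto simp: p intro: differentiableI[OF d])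
qed

lemma smooth_power: "smooth f \<Longrightarrow> smooth (\<lambda>x. f x ^ k)"
  by (induction k) (auto intro: smooth_mult)

lemma smooth_prod: "(\<And>a. a \<in> A \<Longrightarrow> smooth (f a)) \<Longrightarrow> smooth (\<lambda>x. \<Prod>a\<in>A. f a x)"
  by (induction A rule: infinite_finite_induct) (auto intro: smooth_mult)

lemma smooth_monomial: "smooth (monomial \<alpha>)"
proof -
  have "smooth (\<lambda>\<xi>. \<Prod>i\<in>UNIV. of_real (\<xi> $ i) ^ \<alpha> i)"
    by (intro smooth_prod smooth_power smooth_coord)
  then show ?thesis unfolding monomial_def by simp
qed

lemma smooth_poly_fun: "smooth (poly_fun A a)"
  unfolding poly_fun_def by (intro smooth_sum smooth_mult smooth_const smooth_monomial)

lemma mderiv_poly_fun: "mderiv \<beta> (poly_fun A a) \<xi> = (\<Sum>\<alpha>\<in>A. a \<alpha> * mderiv \<beta> (monomial \<alpha>) \<xi>)"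
proof -
  have "foldr pderiv_at is (\<lambda>x. \<Sum>\<alpha>\<in>A. a \<alpha> * monomial \<alpha> x) =
     (\<lambda>x. \<Sum>\<alpha>\<in>A. a \<alpha> * foldr pderiv_at is (monomial \<alpha>) x)" for "is"
    by (subst foldr_pderiv_sum) (auto simp: foldr_pderiv_cmult smooth_monomial intro!: smooth_mult)
  then show ?thesis unfolding mderiv_def poly_fun_def by metis
qed

lemma pderiv_monomial:
  "pderiv_at i (monomial \<alpha>) = (\<lambda>\<xi>. of_nat (\<alpha> i) * monomial (\<alpha>(i := \<alpha> i - 1)) \<xi>)"
proof
  fix \<xi> :: "real^'a"
  define R where "R = (\<Prod>j\<in>UNIV - {i}. (\<xi> $ j) ^ \<alpha> j)"
  have split: "(\<Prod>j\<in>UNIV. (\<eta> $ j) ^ \<beta> j) = (\<eta> $ i) ^ \<beta> i * (\<Prod>j\<in>UNIV - {i}. (\<eta> $ j) ^ \<beta> j)"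
    for \<eta> :: "real^'a" and \<beta> by (simp add: prod.remove)
  have R': "(\<Prod>j\<in>UNIV - {i}. ((\<xi> + t *\<^sub>R axis i 1) $ j) ^ \<alpha> j) = R" for t
    unfolding R_def by (intro prod.cong) (auto simp: axis_def)
  have line: "Re (monomial \<alpha> (\<xi> + t *\<^sub>R axis i 1)) = (\<xi> $ i + t) ^ \<alpha> i * R" for t
    unfolding monomial_def split R' by (simp add: axis_def)
  have "((\<lambda>t. (\<xi> $ i + t) ^ \<alpha> i * R) has_real_derivative real (\<alpha> i) * (\<xi> $ i) ^ (\<alpha> i - 1) * R) (at 0)"
  proof -
    have "((\<lambda>t. \<xi> $ i + t) has_real_derivative 0 + 1) (at 0)"
      by (intro DERIV_add DERIV_const DERIV_ident)
    from DERIV_cmult_right[OF DERIV_power[OF this, of "\<alpha> i"], of R]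
    show ?thesis by simp
  qed
  moreover have "((\<lambda>t. (\<xi> $ i + t) ^ \<alpha> i * R) has_real_derivative Re (pderiv_at i (monomial \<alpha>) \<xi>)) (at 0)"
    using pderiv_line[OF smooth_differentiable[OF smooth_monomial] bounded_linear_Re, of \<alpha> \<xi> i]
    unfolding line .
  ultimately have Re: "Re (pderiv_at i (monomial \<alpha>) \<xi>) = real (\<alpha> i) * (\<xi> $ i) ^ (\<alpha> i - 1) * R"
    using DERIV_unique by blast
  have "Im (monomial \<alpha> \<eta>) = 0" for \<eta> unfolding monomial_def by (rule Im_complex_of_real)
  then have "((\<lambda>t. 0) has_real_derivative Im (pderiv_at i (monomial \<alpha>) \<xi>)) (at 0)"
    using pderiv_line[OF smooth_differentiable[OF smooth_monomial] bounded_linear_Im, of \<alpha> \<xi> i]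
    by simp
  then have Im: "Im (pderiv_at i (monomial \<alpha>) \<xi>) = 0"
    using DERIV_unique[OF _ DERIV_const] by blast
  have "(\<Prod>j\<in>UNIV - {i}. (\<xi> $ j) ^ (\<alpha>(i := \<alpha> i - 1)) j) = R"
    unfolding R_def by (intro prod.cong) auto
  then have "monomial (\<alpha>(i := \<alpha> i - 1)) \<xi> = of_real ((\<xi> $ i) ^ (\<alpha> i - 1) * R)"
    unfolding monomial_def split by simp
  then show "pderiv_at i (monomial \<alpha>) \<xi> = of_nat (\<alpha> i) * monomial (\<alpha>(i := \<alpha> i - 1)) \<xi>"
    using Re Im by (simp add: complex_eq_iff)
qed

lemma foldr_pderiv_monomial_0:
  "mi_order \<alpha> < length is \<Longrightarrow> foldr pderiv_at is (monomial \<alpha>) = (\<lambda>\<xi>. 0)"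
proof (induction "is" arbitrary: \<alpha> rule: rev_induct)
  case (snoc i "is")
  have *: "foldr pderiv_at (is @ [i]) (monomial \<alpha>) =
      (\<lambda>\<xi>. of_nat (\<alpha> i) * foldr pderiv_at is (monomial (\<alpha>(i := \<alpha> i - 1))) \<xi>)"
    by (simp add: pderiv_monomial foldr_pderiv_cmult smooth_monomial)
  show ?case
  proof (cases "\<alpha> i = 0")
    case False
    have "mi_order \<beta> = \<beta> i + (\<Sum>j\<in>UNIV - {i}. \<beta> j)" for \<beta> :: "'a \<Rightarrow> nat" by (simp add: sum.remove)
    moreover have "(\<Sum>j\<in>UNIV - {i}. (\<alpha>(i := \<alpha> i - 1)) j) = (\<Sum>j\<in>UNIV - {i}. \<alpha> j)"
      by (intro sum.cong) auto
    ultimately have "mi_order (\<alpha>(i := \<alpha> i - 1)) < mi_order \<alpha>" using False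
      by (metis One_nat_def add_less_cancel_right diff_less fun_upd_same gr0I lessI)
    then show ?thesis using * snoc by simp
  qed (use * in simp)
qed simp

lemma mderiv_monomial_0:
  assumes "mi_order \<alpha> < mi_order \<beta>" shows "mderiv \<beta> (monomial \<alpha>) = (\<lambda>\<xi>. 0)"
proof -
  obtain "is" where "is": "\<And>i. count_list is i = \<beta> i" using ex_count_list by blast
  have "length is = (\<Sum>i\<in>set is. count_list is i)" by (simp add: sum_count_set)
  also have "\<dots> = (\<Sum>i\<in>UNIV. count_list is i)" by (intro sum.mono_neutral_left) auto
  finally have "length is = mi_order \<beta>" using "is" by simp
  then show ?thesis using foldr_pderiv_monomial_0 mderiv_eq[OF smooth_monomial "is"] assms by metis
qed

lemma tilde_poly_fun:
  assumes "A \<subseteq> {\<alpha>. mi_order \<alpha> \<le> m}"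
  shows "tilde (poly_fun A a) \<xi> =
    L2_set (\<lambda>\<beta>. cmod (mderiv \<beta> (poly_fun A a) \<xi>)) {\<beta>. mi_order \<beta> \<le> m}"
proof -
  have "mderiv \<beta> (poly_fun A a) \<xi> = 0" if "\<not> mi_order \<beta> \<le> m" for \<beta>
    unfolding mderiv_poly_fun using assms that by (intro sum.neutral) (auto simp: mderiv_monomial_0)
  then have "(\<Sum>\<^sub>\<infinity>\<beta>. (cmod (mderiv \<beta> (poly_fun A a) \<xi>))\<^sup>2) =
      (\<Sum>\<^sub>\<infinity>\<beta>\<in>{\<beta>. mi_order \<beta> \<le> m}. (cmod (mderiv \<beta> (poly_fun A a) \<xi>))\<^sup>2)"
    by (intro infsum_cong_neutral) auto
  then show ?thesis by (simp add: tilde_def L2_set_def finite_mi)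
qed

lemma tilde_diff_le:
  "\<bar>tilde (poly_fun {\<alpha>. mi_order \<alpha> \<le> m} a) \<xi> - tilde (poly_fun {\<alpha>. mi_order \<alpha> \<le> m} b) \<xi>\<bar> \<le>
    (\<Sum>\<beta> | mi_order \<beta> \<le> m. \<Sum>\<alpha> | mi_order \<alpha> \<le> m. cmod (a \<alpha> - b \<alpha>) * cmod (mderiv \<beta> (monomial \<alpha>) \<xi>))"
proof -
  let ?M = "{\<alpha> :: 'a \<Rightarrow> nat. mi_order \<alpha> \<le> m}"
  let ?f = "\<lambda>a \<beta>. mderiv \<beta> (poly_fun ?M a) \<xi>"
  have tri: "L2_set (\<lambda>\<beta>. cmod (?f p \<beta>)) ?M \<le> L2_set (\<lambda>\<beta>. cmod (?f q \<beta>)) ?M + L2_set (\<lambda>\<beta>. cmod (?f p \<beta> - ?f q \<beta>)) ?M" for p q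
    by (rule order_trans[OF L2_set_mono L2_set_triangle_ineq]) (auto simp: norm_triangle_sub)
  have "L2_set (\<lambda>\<beta>. cmod (?f a \<beta> - ?f b \<beta>)) ?M \<le> (\<Sum>\<beta>\<in>?M. cmod (?f a \<beta> - ?f b \<beta>))"
    by (rule L2_set_le_sum) auto
  also have "\<dots> \<le> (\<Sum>\<beta>\<in>?M. \<Sum>\<alpha>\<in>?M. cmod (a \<alpha> - b \<alpha>) * cmod (mderiv \<beta> (monomial \<alpha>) \<xi>))"
    unfolding mderiv_poly_fun sum_subtractf[symmetric] left_diff_distrib[symmetric]
    by (intro sum_mono order_trans[OF norm_sum]) (simp add: norm_mult)
  finally show ?thesis
    using tri[of a b] tri[of b a] unfolding tilde_poly_fun[OF subset_refl]
    by (simp add: norm_minus_commute)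
qed

text \<open>For \<open>P(D) = \<Sum>\<^bsub>|\<alpha>| \<le> m\<^esub> c\<^sub>\<alpha> D\<^sup>\<alpha>\<close> with generalized coefficients, \<open>gen_tilde m c \<xi>\<close> is the class
  of the net of values at \<open>\<xi>\<close> of \<open>tilde\<close> of any representing net of polynomials.\<close>

lift_definition gen_tilde :: "nat \<Rightarrow> (('n::finite \<Rightarrow> nat) \<Rightarrow> complex gen_num) \<Rightarrow> real^'n \<Rightarrow> real gen_num"
  is "\<lambda>m p \<xi> \<epsilon>. tilde (poly_fun {\<alpha>. mi_order \<alpha> \<le> m} (\<lambda>\<alpha>. p \<alpha> \<epsilon>)) \<xi>"
proof -
  fix m :: nat and p q :: "('n \<Rightarrow> nat) \<Rightarrow> real \<Rightarrow> complex" and \<xi> :: "real^'n"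
  assume pq: "\<And>\<alpha>. gen_num_rel (p \<alpha>) (q \<alpha>)"
  let ?M = "{\<alpha> :: 'n \<Rightarrow> nat. mi_order \<alpha> \<le> m}"
  let ?t = "\<lambda>p \<epsilon>. tilde (poly_fun ?M (\<lambda>\<alpha>. p \<alpha> \<epsilon>)) \<xi>"
  let ?B = "\<lambda>p q \<epsilon>. \<Sum>\<beta>\<in>?M. \<Sum>\<alpha>\<in>?M. cmod (p \<alpha> \<epsilon> - q \<alpha> \<epsilon>) * cmod (mderiv \<beta> (monomial \<alpha>) \<xi>)"
  have le: "\<bar>?t p \<epsilon> - ?t q \<epsilon>\<bar> \<le> \<bar>?B p q \<epsilon>\<bar>" for p q \<epsilon>
    by (rule order_trans[OF tilde_diff_le abs_ge_self])
  have z: "?t (\<lambda>\<alpha> \<epsilon>. 0) \<epsilon> = 0" for \<epsilon>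
    unfolding tilde_poly_fun[OF subset_refl] mderiv_poly_fun by (simp add: L2_set_def)
  have mod: "moderate_num (?t p)" if "\<And>\<alpha>. moderate_num (p \<alpha>)" for p
  proof -
    have "unif_mod {()} (\<lambda>\<epsilon> _. ?B p (\<lambda>\<alpha> \<epsilon>. 0) \<epsilon>)"
      using that by (intro unif_mod_sum unif_mod_mult unif_mod_const unif_mod_norm) (simp add: moderate_num_iff)
    then show ?thesis unfolding moderate_num_iff
      by (rule unif_mod_cong) (use le[of p _ "\<lambda>\<alpha> \<epsilon>. 0"] z in simp)
  qed
  have "unif_neg {()} (\<lambda>\<epsilon> _. ?B p q \<epsilon>)"
    using pq by (intro unif_neg_sum unif_neg_mult' unif_mod_const unif_neg_norm)
       (simp add: gen_num_rel_def negligible_num_iff)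
  then have "negligible_num (\<lambda>\<epsilon>. ?t p \<epsilon> - ?t q \<epsilon>)" unfolding negligible_num_iff
    by (rule unif_neg_cong) (use le[of p _ q] in simp)
  then show "gen_num_rel (?t p) (?t q)"
    using mod pq by (simp add: gen_num_rel_def)
qed

text \<open>A net of polynomials \<open>\<Sum>\<^bsub>\<alpha>\<in>A\<^esub> p \<alpha> \<epsilon> \<xi>\<^sup>\<alpha>\<close> representing \<open>\<Sum>\<^bsub>\<alpha>\<in>A\<^esub> c\<^sub>\<alpha> \<xi>\<^sup>\<alpha>\<close>.\<close>

definition represents_poly ::
    "('n::finite \<Rightarrow> nat) set \<Rightarrow> (('n \<Rightarrow> nat) \<Rightarrow> real \<Rightarrow> complex) \<Rightarrow>
      (('n \<Rightarrow> nat) \<Rightarrow> complex gen_num) \<Rightarrow> bool" where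
  "represents_poly A p c \<longleftrightarrow> (\<forall>\<alpha>\<in>A. represents_num (p \<alpha>) (c \<alpha>))"

definition G_elliptic :: "nat \<Rightarrow> (('n::finite \<Rightarrow> nat) \<Rightarrow> complex gen_num) \<Rightarrow> bool" where
  "G_elliptic m c \<longleftrightarrow>
    (\<exists>p. represents_poly {\<alpha>. mi_order \<alpha> = m} p c \<and>
      (\<exists>C>0. \<exists>a::real. \<forall>\<epsilon>\<in>{0<..1}. \<forall>\<xi>.
        cmod (poly_fun {\<alpha>. mi_order \<alpha> = m} (\<lambda>\<alpha>. p \<alpha> \<epsilon>) \<xi>) \<ge> C * \<epsilon> powr a * norm \<xi> ^ m))"

text \<open>\<open>stronger m c k d\<close>: the operator of order \<open>m\<close> with coefficients \<open>c\<close> is stronger than the operator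
  of order \<open>k\<close> with coefficients \<open>d\<close>.\<close>

definition stronger ::
    "nat \<Rightarrow> (('n::finite \<Rightarrow> nat) \<Rightarrow> complex gen_num) \<Rightarrow>
     nat \<Rightarrow> (('n \<Rightarrow> nat) \<Rightarrow> complex gen_num) \<Rightarrow> bool" where
  "stronger m c k d \<longleftrightarrow>
    (\<exists>p q. \<exists>L :: real \<Rightarrow> real.
      represents_poly {\<alpha>. mi_order \<alpha> \<le> m} p c \<and>
      represents_poly {\<alpha>. mi_order \<alpha> \<le> k} q d \<and> moderate_num L \<and>
      (\<forall>\<xi>. \<forall>\<epsilon>\<in>{0<..1}. tilde (poly_fun {\<alpha>. mi_order \<alpha> \<le> k} (\<lambda>\<alpha>. q \<alpha> \<epsilon>)) \<xi>
        \<le> L \<epsilon> * tilde (poly_fun {\<alpha>. mi_order \<alpha> \<le> m} (\<lambda>\<alpha>. p \<alpha> \<epsilon>)) \<xi>))"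

end

theory Submission
  imports Defs
begin

text \<open>Freeze the coefficients at \<open>x\<^sub>0\<close>: take \<open>P\<^sub>0(D) = P(x\<^sub>0,D)\<close>, let the \<open>c\<^sub>j\<close> be the differences
  \<open>c\<^sub>\<alpha> - c\<^sub>\<alpha>(x\<^sub>0)\<close> and the \<open>P\<^sub>j(D)\<close> the monomials \<open>D\<^sup>\<alpha>\<close>.  Ellipticity with constant \<open>c\<close> forces some top order
  coefficient to have modulus at least \<open>c / N\<close>, where \<open>N\<close> is the number of indices of order \<open>m\<close>; up to a
  factorial this coefficient is a derivative of the symbol, so its tilde is at least \<open>c / N\<close> everywhere.
  If \<open>M\<close> is the sum of the moduli of all coefficients, the principal part dominates for
  \<open>|\<xi>| \<ge> 1 + 2 M / c\<close>.  Together, the tilde dominates \<open>(1 + |\<xi>|)\<^sup>m\<close> up to a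
  factor that is polynomial in \<open>M\<close> and \<open>1 / c\<close>, hence moderate.\<close>

section \<open>Multi-indices and derivatives of monomials\<close>

lemma sum_mi_delta:
  "mi_order \<beta> \<le> m \<Longrightarrow> (\<Sum>\<alpha> | mi_order \<alpha> \<le> m. if \<alpha> = \<beta> then f \<alpha> else 0) = f \<beta>"
  by (subst sum.delta[OF finite_mi]) simp

lemma mi_order_decrease:
  assumes "\<alpha> i > 0" shows "Suc (mi_order (\<alpha>(i := \<alpha> i - 1))) = mi_order (\<alpha> :: 'n::finite \<Rightarrow> nat)"
proof -
  have "(\<Sum>j\<in>UNIV - {i}. (\<alpha>(i := \<alpha> i - 1)) j) = (\<Sum>j\<in>UNIV - {i}. \<alpha> j)"
    by (intro sum.cong) auto
  moreover have "mi_order \<beta> = \<beta> i + (\<Sum>j\<in>UNIV - {i}. \<beta> j)" for \<beta> :: "'n \<Rightarrow> nat"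
    by (simp add: sum.remove)
  ultimately show ?thesis using assms by (metis One_nat_def Suc_pred add_Suc fun_upd_same)
qed

lemma norm_monomial_le: "cmod (monomial \<alpha> \<xi>) \<le> norm \<xi> ^ mi_order \<alpha>"
proof -
  have "cmod (monomial \<alpha> \<xi>) = (\<Prod>i\<in>UNIV. \<bar>\<xi> $ i\<bar> ^ \<alpha> i)"
    unfolding monomial_def norm_of_real by (simp add: abs_prod power_abs)
  also have "\<dots> \<le> (\<Prod>i\<in>UNIV. norm \<xi> ^ \<alpha> i)"
    by (intro prod_mono conjI power_mono component_le_norm_cart) auto
  finally show ?thesis by (simp add: power_sum)
qed

text \<open>The last entry of the list acts first and turns a monomial into a multiple of a
  monomial. This is why the inductions on lists of derivatives run from the right.\<close>

lemma foldr_pderiv_monomial_step: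
  "foldr pderiv_at (is @ [i]) (monomial \<alpha>) =
    (\<lambda>\<xi>. of_nat (\<alpha> i) * foldr pderiv_at is (monomial (\<alpha>(i := \<alpha> i - 1))) \<xi>)"
  by (simp add: pderiv_monomial foldr_pderiv_cmult smooth_monomial)

text \<open>Each differentiation can only lower the degree. Since \<open>1 + norm \<xi>\<close> is
  at least 1, the original exponent may be kept throughout, which gives all derivatives the same
  growth rate.\<close>

lemma foldr_pderiv_monomial_bound:
  "\<exists>B\<ge>0. \<forall>\<xi>. cmod (foldr pderiv_at is (monomial \<alpha>) \<xi>) \<le> B * (1 + norm \<xi>) ^ mi_order \<alpha>"
proof (induction "is" arbitrary: \<alpha> rule: rev_induct)
  case Nil
  have "cmod (monomial \<alpha> \<xi>) \<le> 1 * (1 + norm \<xi>) ^ mi_order \<alpha>" for \<xi>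
    using norm_monomial_le[of \<alpha> \<xi>] power_mono[of "norm \<xi>" "1 + norm \<xi>" "mi_order \<alpha>"] by simp
  then show ?case by (intro exI[of _ 1]) simp
next
  case (snoc i "is")
  let ?\<beta> = "\<alpha>(i := \<alpha> i - 1)"
  obtain B where B: "B \<ge> 0"
    "\<And>\<xi>. cmod (foldr pderiv_at is (monomial ?\<beta>) \<xi>) \<le> B * (1 + norm \<xi>) ^ mi_order ?\<beta>"
    using snoc[of ?\<beta>] by blast
  have "mi_order ?\<beta> \<le> mi_order \<alpha>" by (intro sum_mono) auto
  then have "B * (1 + norm \<xi>) ^ mi_order ?\<beta> \<le> B * (1 + norm \<xi>) ^ mi_order \<alpha>" for \<xi> :: "real^'a"
    using B(1) by (intro mult_left_mono power_increasing) auto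
  then have "cmod (foldr pderiv_at is (monomial ?\<beta>) \<xi>) \<le> B * (1 + norm \<xi>) ^ mi_order \<alpha>" for \<xi>
    using B(2) order_trans by blast
  then have "real (\<alpha> i) * cmod (foldr pderiv_at is (monomial ?\<beta>) \<xi>)
      \<le> real (\<alpha> i) * (B * (1 + norm \<xi>) ^ mi_order \<alpha>)" for \<xi>
    by (intro mult_left_mono) auto
  then show ?case unfolding foldr_pderiv_monomial_step using B(1)
    by (intro exI[of _ "real (\<alpha> i) * B"]) (auto simp: norm_mult mult.assoc)
qed

lemma mderiv_monomial_bound:
  "\<exists>B\<ge>0. \<forall>\<xi>. cmod (mderiv \<beta> (monomial \<alpha>) \<xi>) \<le> B * (1 + norm \<xi>) ^ mi_order \<alpha>"
  using foldr_pderiv_monomial_bound unfolding mderiv_def by blast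

text \<open>With at least as many derivatives as the degree, a monomial survives only if its
  exponents are matched exactly, and what remains is the product of their factorials. Only the bound
  \<open>k \<ge> 1\<close> on this product is recorded.\<close>

lemma foldr_pderiv_monomial_top:
  "mi_order \<alpha> \<le> length is \<Longrightarrow>
    \<exists>k\<ge>1. foldr pderiv_at is (monomial \<alpha>) = (\<lambda>\<xi>. if count_list is = \<alpha> then of_nat k else 0)"
proof (induction "is" arbitrary: \<alpha> rule: rev_induct)
  case Nil
  then have "\<alpha> = (\<lambda>i. 0)" by auto
  then show ?case by (intro exI[of _ 1]) (auto simp: monomial_def)
next
  case (snoc i "is")
  let ?\<beta> = "\<alpha>(i := \<alpha> i - 1)"
  show ?case
  proof (cases "\<alpha> i = 0")
    case True
    \<comment> \<open>The derivative in a variable with exponent 0 vanishes, and the right-hand side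
      is 0 as well because \<open>i\<close> occurs in the list; any positive \<open>k\<close> is a
      witness.\<close>
    then have "count_list (is @ [i]) \<noteq> \<alpha>" by (auto simp: fun_eq_iff intro!: exI[of _ i])
    then show ?thesis unfolding foldr_pderiv_monomial_step using True by auto
  next
    case False
    then have "mi_order ?\<beta> \<le> length is" using snoc.prems mi_order_decrease[of \<alpha> i] by simp
    then obtain k where k: "k \<ge> 1"
      "foldr pderiv_at is (monomial ?\<beta>) = (\<lambda>\<xi>. if count_list is = ?\<beta> then of_nat k else 0)"
      using snoc.IH by blast
    have "count_list is = ?\<beta> \<longleftrightarrow> count_list (is @ [i]) = \<alpha>"
    proof
      assume "count_list is = ?\<beta>"
      then show "count_list (is @ [i]) = \<alpha>" using False by (auto simp: fun_eq_iff)
    next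
      assume "count_list (is @ [i]) = \<alpha>"
      then have "\<alpha> j = count_list is j + (if i = j then 1 else 0)" for j by auto
      then show "count_list is = ?\<beta>" by (auto simp: fun_eq_iff)
    qed
    then show ?thesis unfolding foldr_pderiv_monomial_step k(2) using k(1) False
      by (intro exI[of _ "\<alpha> i * k"]) (auto simp: fun_eq_iff)
  qed
qed

lemma mderiv_monomial_top:
  assumes "mi_order \<alpha> \<le> mi_order \<beta>"
  shows "\<exists>k\<ge>1. mderiv \<beta> (monomial \<alpha>) = (\<lambda>\<xi>. if \<alpha> = \<beta> then of_nat k else 0)"
proof -
  obtain "is" where "is": "\<And>i. count_list is i = \<beta> i" using ex_count_list by blast
  have "length is = (\<Sum>i\<in>set is. count_list is i)" by (simp add: sum_count_set)
  also have "\<dots> = (\<Sum>i\<in>UNIV. count_list is i)" by (intro sum.mono_neutral_left) auto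
  finally have "mi_order \<alpha> \<le> length is" using assms "is" by simp
  moreover have "count_list is = \<beta>" using "is" by auto
  ultimately show ?thesis
    using foldr_pderiv_monomial_top[of \<alpha> "is"] mderiv_eq[OF smooth_monomial "is"] by (auto simp: eq_commute)
qed

section \<open>Bounds for the tilde of a polynomial\<close>

lemma norm_mderiv_le_tilde:
  assumes "mi_order \<beta> \<le> m"
  shows "cmod (mderiv \<beta> (poly_fun {\<alpha>. mi_order \<alpha> \<le> m} a) \<xi>) \<le> tilde (poly_fun {\<alpha>. mi_order \<alpha> \<le> m} a) \<xi>"
  unfolding tilde_poly_fun[OF subset_refl]
  by (rule member_le_L2_set) (use assms finite_mi in auto)

lemma norm_poly_fun_le_tilde:
  "cmod (poly_fun {\<alpha>. mi_order \<alpha> \<le> m} a \<xi>) \<le> tilde (poly_fun {\<alpha>. mi_order \<alpha> \<le> m} a) \<xi>"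
  using norm_mderiv_le_tilde[of "\<lambda>i. 0" m a \<xi>] by simp

text \<open>Among the monomials of order at most \<open>m\<close>, the derivative of index
  \<open>\<beta>\<close> kills all but the one with exponent \<open>\<beta>\<close>. It leaves a
  constant multiple of \<open>a \<beta>\<close> with factor at least 1, so the bound is independent
  of \<open>\<xi>\<close>.\<close>

lemma norm_top_coeff_le_tilde:
  assumes "mi_order \<beta> = m"
  shows "cmod (a \<beta>) \<le> tilde (poly_fun {\<alpha>. mi_order \<alpha> \<le> m} a) \<xi>"
proof -
  have "mi_order \<beta> \<le> mi_order \<beta>" by simp
  then obtain k where k: "k \<ge> 1" "mderiv \<beta> (monomial \<beta>) = (\<lambda>\<xi>. of_nat k)"
    using mderiv_monomial_top[of \<beta> \<beta>] by auto
  have "mderiv \<beta> (poly_fun {\<alpha>. mi_order \<alpha> \<le> m} a) \<xi> =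
      (\<Sum>\<alpha> | mi_order \<alpha> \<le> m. if \<alpha> = \<beta> then a \<beta> * of_nat k else 0)"
    unfolding mderiv_poly_fun
  proof (rule sum.cong)
    fix \<alpha> :: "'a \<Rightarrow> nat" assume "\<alpha> \<in> {\<alpha>. mi_order \<alpha> \<le> m}"
    then have "mi_order \<alpha> \<le> mi_order \<beta>" using assms by simp
    from mderiv_monomial_top[OF this]
    show "a \<alpha> * mderiv \<beta> (monomial \<alpha>) \<xi> = (if \<alpha> = \<beta> then a \<beta> * of_nat k else 0)"
      using k(2) by auto
  qed simp
  also have "\<dots> = a \<beta> * of_nat k" using assms by (intro sum_mi_delta) simp
  finally have "cmod (a \<beta>) * real k \<le> tilde (poly_fun {\<alpha>. mi_order \<alpha> \<le> m} a) \<xi>"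
    using norm_mderiv_le_tilde[of \<beta> m a \<xi>] assms by (simp add: norm_mult)
  moreover have "cmod (a \<beta>) * 1 \<le> cmod (a \<beta>) * real k" using k(1) by (intro mult_left_mono) auto
  ultimately show ?thesis by linarith
qed

text \<open>The coefficients of a single monomial. The value type is left open because both complex
  numbers and generalized numbers occur as coefficients.\<close>

abbreviation unit_coeff :: "'a \<Rightarrow> 'a \<Rightarrow> 'b::zero_neq_one" where
  "unit_coeff \<alpha> \<equiv> \<lambda>\<beta>. if \<beta> = \<alpha> then 1 else 0"

text \<open>The Euclidean norm of the derivatives is at most their sum, and each of them grows no
  faster than the monomial. The exponent is raised to \<open>m\<close> so that it fits the lower
  bound for elliptic polynomials.\<close>

lemma tilde_monomial_bound:
  assumes "mi_order \<alpha> \<le> m"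
  shows "\<exists>B\<ge>0. \<forall>\<xi>. tilde (poly_fun {\<beta>. mi_order \<beta> \<le> m} (unit_coeff \<alpha>)) \<xi> \<le> B * (1 + norm \<xi>) ^ m"
proof -
  let ?A = "{\<beta>. mi_order \<beta> \<le> m}"
  from mderiv_monomial_bound[of _ \<alpha>] obtain B
    where B: "\<And>\<beta>. B \<beta> \<ge> 0" "\<And>\<beta> \<xi>. cmod (mderiv \<beta> (monomial \<alpha>) \<xi>) \<le> B \<beta> * (1 + norm \<xi>) ^ mi_order \<alpha>"
    by metis
  have "tilde (poly_fun ?A (unit_coeff \<alpha>)) \<xi> \<le> (\<Sum>\<beta>\<in>?A. B \<beta>) * (1 + norm \<xi>) ^ m" for \<xi>
  proof -
    have "poly_fun ?A (unit_coeff \<alpha>) = (\<lambda>\<xi>. \<Sum>\<beta>\<in>?A. if \<beta> = \<alpha> then monomial \<beta> \<xi> else 0)"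
      unfolding poly_fun_def by (intro ext sum.cong) auto
    then have eq: "poly_fun ?A (unit_coeff \<alpha>) = monomial \<alpha>"
      by (simp only: sum_mi_delta[OF assms])
    have "tilde (poly_fun ?A (unit_coeff \<alpha>)) \<xi> \<le> (\<Sum>\<beta>\<in>?A. cmod (mderiv \<beta> (monomial \<alpha>) \<xi>))"
      unfolding tilde_poly_fun[OF subset_refl] unfolding eq by (rule L2_set_le_sum) auto
    also have "\<dots> \<le> (\<Sum>\<beta>\<in>?A. B \<beta> * (1 + norm \<xi>) ^ m)"
      using assms by (intro sum_mono order_trans[OF B(2)] mult_left_mono power_increasing B(1)) auto
    finally show ?thesis by (simp add: sum_distrib_right)
  qed
  then show ?thesis using B(1) by (intro exI[of _ "\<Sum>\<beta>\<in>?A. B \<beta>"]) (auto intro: sum_nonneg)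
qed

section \<open>Elliptic polynomials with a fixed ellipticity constant\<close>

context
  fixes m :: nat and a :: "('n::finite \<Rightarrow> nat) \<Rightarrow> complex" and c :: real
  assumes c: "c > 0"
    and elliptic: "\<And>\<xi>. cmod (poly_fun {\<alpha>. mi_order \<alpha> = m} a \<xi>) \<ge> c * norm \<xi> ^ m"
begin

text \<open>At a unit vector, ellipticity bounds \<open>c\<close> by the sum of the moduli of the
  top coefficients, and each of these is at most the tilde at any point. As \<open>c > 0\<close>,
  that sum cannot be empty.\<close>

lemma elliptic_tilde_lower:
  "c / real (card {\<alpha> :: 'n \<Rightarrow> nat. mi_order \<alpha> = m}) \<le> tilde (poly_fun {\<alpha>. mi_order \<alpha> \<le> m} a) \<xi>"
    and elliptic_card_pos: "card {\<alpha> :: 'n \<Rightarrow> nat. mi_order \<alpha> = m} > 0"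
proof -
  let ?E = "{\<alpha> :: 'n \<Rightarrow> nat. mi_order \<alpha> = m}" and ?T = "tilde (poly_fun {\<alpha>. mi_order \<alpha> \<le> m} a) \<xi>"
  \<comment> \<open>The vector \<open>e\<close> serves only to evaluate the ellipticity estimate; it
    is unrelated to the point \<open>\<xi>\<close> of the tilde.\<close>
  define e :: "real^'n" where "e = axis undefined 1"
  have e: "norm e = 1" by (simp add: e_def)
  have "c \<le> cmod (poly_fun ?E a e)" using elliptic[of e] e by simp
  also have "\<dots> \<le> (\<Sum>\<alpha>\<in>?E. cmod (a \<alpha>) * cmod (monomial \<alpha> e))"
    unfolding poly_fun_def by (rule order_trans[OF norm_sum]) (simp add: norm_mult)
  also have "\<dots> \<le> (\<Sum>\<alpha>\<in>?E. ?T)"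
  proof (rule sum_mono)
    fix \<alpha> :: "'n \<Rightarrow> nat" assume "\<alpha> \<in> ?E"
    then have "cmod (a \<alpha>) \<le> ?T" using norm_top_coeff_le_tilde[of \<alpha>] by blast
    moreover have "cmod (a \<alpha>) * cmod (monomial \<alpha> e) \<le> cmod (a \<alpha>) * 1"
      using norm_monomial_le[of \<alpha> e] e by (intro mult_left_mono) auto
    ultimately show "cmod (a \<alpha>) * cmod (monomial \<alpha> e) \<le> ?T" by linarith
  qed
  finally have le: "c \<le> real (card ?E) * ?T" by simp
  then show pos: "card ?E > 0" using c by (cases "card ?E = 0") auto
  show "c / real (card ?E) \<le> ?T" using le pos by (simp add: divide_le_eq mult.commute)
qed

text \<open>In the radius, the summand 1 makes powers of \<open>norm \<xi>\<close> increase with the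
  exponent, and \<open>2 * M / c\<close> lets half of the principal part absorb the lower order
  terms.\<close>

lemma elliptic_growth:
  assumes R: "norm \<xi> \<ge> 1 + 2 * (\<Sum>\<alpha> | mi_order \<alpha> \<le> m. cmod (a \<alpha>)) / c"
  shows "c / 2 * norm \<xi> ^ m \<le> tilde (poly_fun {\<alpha>. mi_order \<alpha> \<le> m} a) \<xi>"
proof -
  let ?A = "{\<alpha> :: 'n \<Rightarrow> nat. mi_order \<alpha> \<le> m}" and ?E = "{\<alpha> :: 'n \<Rightarrow> nat. mi_order \<alpha> = m}"
  define M where "M = (\<Sum>\<alpha>\<in>?A. cmod (a \<alpha>))"
  have M: "M \<ge> 0" unfolding M_def by (intro sum_nonneg) auto
  have ge1: "norm \<xi> \<ge> 1" and ge: "norm \<xi> \<ge> 2 * M / c"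
    using R M c divide_nonneg_pos[of "2 * M" c] unfolding M_def[symmetric] by linarith+
  have split: "poly_fun ?A a \<xi> = poly_fun ?E a \<xi> + poly_fun (?A - ?E) a \<xi>"
    unfolding poly_fun_def using finite_mi[of m] by (subst sum.subset_diff[of ?E]) auto
  \<comment> \<open>Multiplying by \<open>norm \<xi>\<close> avoids the exponent
    \<open>m - 1\<close>, so that \<open>m = 0\<close> needs no separate case.\<close>
  have "norm \<xi> * cmod (poly_fun (?A - ?E) a \<xi>) \<le> norm \<xi> * (\<Sum>\<alpha>\<in>?A - ?E. cmod (a \<alpha>) * cmod (monomial \<alpha> \<xi>))"
    unfolding poly_fun_def by (intro mult_left_mono order_trans[OF norm_sum]) (auto simp: norm_mult)
  also have "\<dots> = (\<Sum>\<alpha>\<in>?A - ?E. cmod (a \<alpha>) * (norm \<xi> * cmod (monomial \<alpha> \<xi>)))"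
    by (simp add: sum_distrib_left mult_ac)
  also have "\<dots> \<le> (\<Sum>\<alpha>\<in>?A - ?E. cmod (a \<alpha>) * norm \<xi> ^ m)"
  proof (intro sum_mono mult_left_mono)
    fix \<alpha> :: "'n \<Rightarrow> nat" assume "\<alpha> \<in> ?A - ?E"
    then have lt: "Suc (mi_order \<alpha>) \<le> m" by auto
    have "norm \<xi> * cmod (monomial \<alpha> \<xi>) \<le> norm \<xi> ^ Suc (mi_order \<alpha>)"
      using norm_monomial_le[of \<alpha> \<xi>] by (simp add: mult_left_mono)
    also have "\<dots> \<le> norm \<xi> ^ m" using lt ge1 by (rule power_increasing)
    finally show "norm \<xi> * cmod (monomial \<alpha> \<xi>) \<le> norm \<xi> ^ m" .
  qed auto
  also have "\<dots> \<le> M * norm \<xi> ^ m"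
    unfolding M_def sum_distrib_right[symmetric] using finite_mi[of m]
    by (intro mult_right_mono sum_mono2) auto
  also have "\<dots> \<le> (c / 2 * norm \<xi>) * norm \<xi> ^ m"
    using ge c by (intro mult_right_mono) (auto simp: field_simps)
  finally have "norm \<xi> * cmod (poly_fun (?A - ?E) a \<xi>) \<le> norm \<xi> * (c / 2 * norm \<xi> ^ m)"
    by (simp add: mult_ac)
  then have "cmod (poly_fun (?A - ?E) a \<xi>) \<le> c / 2 * norm \<xi> ^ m"
    by (rule mult_left_le_imp_le) (use ge1 in linarith)
  moreover have "c * norm \<xi> ^ m - cmod (poly_fun (?A - ?E) a \<xi>) \<le> cmod (poly_fun ?A a \<xi>)"
    unfolding split using elliptic[of \<xi>] norm_diff_ineq order_trans by (smt (verit))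
  ultimately show ?thesis using norm_poly_fun_le_tilde[of m a \<xi>] by linarith
qed

text \<open>One constant covers both regimes. Outside the radius, \<open>2 ^ m\<close> and
  \<open>2 / c\<close> are needed; inside it, \<open>(2 + 2 * M / c) ^ m\<close> bounds the
  left-hand side and \<open>N / c\<close> comes from the uniform lower bound of the tilde.\<close>

lemma elliptic_dominates:
  "(1 + norm \<xi>) ^ m \<le>
    (2 + 2 * (\<Sum>\<alpha> | mi_order \<alpha> \<le> m. cmod (a \<alpha>)) / c) ^ m *
    ((real (card {\<alpha> :: 'n \<Rightarrow> nat. mi_order \<alpha> = m}) + 2) / c) * tilde (poly_fun {\<alpha>. mi_order \<alpha> \<le> m} a) \<xi>"
proof -
  define M where "M = (\<Sum>\<alpha> | mi_order \<alpha> \<le> m. cmod (a \<alpha>))"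
  define N where "N = real (card {\<alpha> :: 'n \<Rightarrow> nat. mi_order \<alpha> = m})"
  define T where "T = tilde (poly_fun {\<alpha>. mi_order \<alpha> \<le> m} a) \<xi>"
  have M: "M \<ge> 0" unfolding M_def by (intro sum_nonneg) auto
  then have Mc: "M / c \<ge> 0" using c by simp
  have N: "N > 0" unfolding N_def using elliptic_card_pos by simp
  have T: "c / N \<le> T" unfolding N_def T_def by (rule elliptic_tilde_lower)
  then have Tpos: "T > 0" using c N by (metis divide_pos_pos order_less_le_trans)
  show ?thesis
  proof (cases "norm \<xi> \<ge> 1 + 2 * M / c")
    case True
    then have ge1: "norm \<xi> \<ge> 1" using Mc by simp
    have "c / 2 * norm \<xi> ^ m \<le> T" using elliptic_growth[of \<xi>] True unfolding M_def T_def by blast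
    then have le: "norm \<xi> ^ m \<le> 2 / c * T" using c by (simp add: field_simps)
    have "(1 + norm \<xi>) ^ m \<le> (2 * norm \<xi>) ^ m" using ge1 by (intro power_mono) auto
    also have "\<dots> = 2 ^ m * norm \<xi> ^ m" by (simp add: power_mult_distrib)
    also have "\<dots> \<le> (2 + 2 * M / c) ^ m * ((N + 2) / c * T)"
    proof (rule mult_mono)
      show "norm \<xi> ^ m \<le> (N + 2) / c * T"
        by (rule order_trans[OF le]) (use c N Tpos in \<open>auto intro!: mult_right_mono divide_right_mono\<close>)
    qed (use Mc in \<open>auto intro!: power_mono\<close>)
    finally show ?thesis unfolding M_def N_def T_def by (simp add: mult.assoc)
  next
    case False
    have "1 \<le> N / c * T" using T c N by (simp add: field_simps)
    also have "\<dots> \<le> (N + 2) / c * T"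
      using c N Tpos by (auto intro!: mult_right_mono divide_right_mono)
    finally have 1: "1 \<le> (N + 2) / c * T" .
    have "(1 + norm \<xi>) ^ m \<le> (2 + 2 * M / c) ^ m" using False by (intro power_mono) auto
    also have "\<dots> \<le> (2 + 2 * M / c) ^ m * ((N + 2) / c * T)"
      using mult_left_mono[OF 1, of "(2 + 2 * M / c) ^ m"] Mc by simp
    finally show ?thesis unfolding M_def N_def T_def by (simp add: mult.assoc)
  qed
qed

end

section \<open>Moderate nets, representatives and generalized numbers\<close>

lemma moderate_num_sum: "(\<And>a. a \<in> A \<Longrightarrow> moderate_num (f a)) \<Longrightarrow> moderate_num (\<lambda>\<epsilon>. \<Sum>a\<in>A. f a \<epsilon>)"
  by (induction A rule: infinite_finite_induct) auto

lemma moderate_num_power: "moderate_num u \<Longrightarrow> moderate_num (\<lambda>\<epsilon>. u \<epsilon> ^ k)"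
  by (induction k) auto

lemma moderate_num_norm: "moderate_num u \<Longrightarrow> moderate_num (\<lambda>\<epsilon>. norm (u \<epsilon>))"
  by (simp add: moderate_num_def)

lemma moderate_num_mono:
  "moderate_num v \<Longrightarrow> (\<And>\<epsilon>. \<epsilon> \<in> {0<..1} \<Longrightarrow> norm (u \<epsilon>) \<le> norm (v \<epsilon>)) \<Longrightarrow> moderate_num u"
  unfolding moderate_num_iff by (erule unif_mod_cong) auto

lemma moderate_num_powr: "moderate_num (\<lambda>\<epsilon>. \<epsilon> powr a :: real)"
  unfolding moderate_num_iff unif_mod_def unif_bound_def
  by (rule exI[of _ a], rule exI[of _ 1]) simp

lemma represents_num_ex: "\<exists>u. represents_num u x"
proof -
  have "gen_num_rel (rep_gen_num x) (rep_gen_num x)" "abs_gen_num (rep_gen_num x) = x"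
    by (rule Quotient3_rep_reflp[OF Quotient3_gen_num], rule Quotient3_abs_rep[OF Quotient3_gen_num])
  then show ?thesis unfolding represents_num_def gen_num_rel_def by blast
qed

lemma gen_num_rel_refl: "moderate_num u \<Longrightarrow> gen_num_rel u u"
  by (simp add: gen_num_rel_def)

lemma abs_gen_num_eqI:
  assumes "moderate_num u" "moderate_num v" "\<And>\<epsilon>. \<epsilon> \<in> {0<..1} \<Longrightarrow> u \<epsilon> = v \<epsilon>"
  shows "abs_gen_num u = abs_gen_num v"
proof -
  have "unif_neg {()} (\<lambda>\<epsilon> _. u \<epsilon> - v \<epsilon>)"
    by (rule unif_neg_cong[OF unif_neg_zero]) (use assms(3) in auto)
  then have "gen_num_rel u v" using assms by (simp add: gen_num_rel_def negligible_num_iff)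
  then show ?thesis using Quotient3_rel_abs[OF Quotient3_gen_num] by blast
qed

lemma const_fun_0: "const_fun 0 = 0" and const_fun_1: "const_fun 1 = 1"
  by (transfer, simp add: colombeau_rel_iff)+

lemma point_value_diff_const: "point_value (u - const_fun (point_value u x)) x = 0"
  unfolding minus_colombeau_def
  by transfer (auto simp: gen_num_rel_def)

lemma gen_tilde_abs:
  assumes "\<And>\<alpha>. moderate_num (p \<alpha>)"
  shows "gen_tilde m (\<lambda>\<alpha>. abs_gen_num (p \<alpha>)) \<xi> =
    abs_gen_num (\<lambda>\<epsilon>. tilde (poly_fun {\<alpha>. mi_order \<alpha> \<le> m} (\<lambda>\<alpha>. p \<alpha> \<epsilon>)) \<xi>)"
  using gen_tilde.abs_eq[of p m \<xi>] assms by (simp add: gen_num_rel_refl rel_fun_def map_fun_def comp_def)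

lemma const_diff_op_unit:
  assumes "mi_order \<alpha> \<le> m" shows "const_diff_op m (unit_coeff \<alpha>) u = D_op \<alpha> u"
proof -
  have "const_diff_op m (unit_coeff \<alpha>) u = (\<Sum>\<beta> | mi_order \<beta> \<le> m. if \<beta> = \<alpha> then D_op \<alpha> u else 0)"
    unfolding const_diff_op_def diff_op_def
    by (intro sum.cong) (auto simp: const_fun_0 const_fun_1)
  then show ?thesis by (simp only: sum_mi_delta[OF assms])
qed

section \<open>Elliptic operators with generalized coefficients\<close>

lemma G_elliptic_representative:
  assumes "G_elliptic m (c :: ('n::finite \<Rightarrow> nat) \<Rightarrow> complex gen_num)"
  obtains p and d :: "real \<Rightarrow> real" where "\<And>\<alpha>. represents_num (p \<alpha>) (c \<alpha>)" "moderate_num (\<lambda>\<epsilon>. 1 / d \<epsilon>)"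
    "\<And>\<epsilon>. \<epsilon> \<in> {0<..1} \<Longrightarrow> d \<epsilon> > 0"
    "\<And>\<epsilon> \<xi>. \<epsilon> \<in> {0<..1} \<Longrightarrow> cmod (poly_fun {\<alpha>. mi_order \<alpha> = m} (\<lambda>\<alpha>. p \<alpha> \<epsilon>) \<xi>) \<ge> d \<epsilon> * norm \<xi> ^ m"
proof -
  let ?E = "{\<alpha> :: 'n \<Rightarrow> nat. mi_order \<alpha> = m}"
  obtain p\<^sub>0 C a where p\<^sub>0: "represents_poly ?E p\<^sub>0 c" and C: "C > 0"
    and ell: "\<And>\<epsilon> \<xi>. \<epsilon> \<in> {0<..1} \<Longrightarrow> cmod (poly_fun ?E (\<lambda>\<alpha>. p\<^sub>0 \<alpha> \<epsilon>) \<xi>) \<ge> C * \<epsilon> powr a * norm \<xi> ^ m"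
    using assms unfolding G_elliptic_def by blast
  obtain p\<^sub>1 where p\<^sub>1: "\<And>\<alpha>. represents_num (p\<^sub>1 \<alpha>) (c \<alpha>)"
    using choice[of "\<lambda>\<alpha> u. represents_num u (c \<alpha>)"] represents_num_ex by blast
  \<comment> \<open>Ellipticity provides representatives of the top order coefficients only, and
    these must be kept for the estimate; all other coefficients get arbitrary ones.\<close>
  define p where "p = (\<lambda>\<alpha>. if \<alpha> \<in> ?E then p\<^sub>0 \<alpha> else p\<^sub>1 \<alpha>)"
  have "poly_fun ?E (\<lambda>\<alpha>. p \<alpha> \<epsilon>) = poly_fun ?E (\<lambda>\<alpha>. p\<^sub>0 \<alpha> \<epsilon>)" for \<epsilon>
    unfolding poly_fun_def p_def by (intro ext sum.cong) auto
  moreover have "represents_num (p \<alpha>) (c \<alpha>)" for \<alpha>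
    using p\<^sub>0 p\<^sub>1 by (auto simp: p_def represents_poly_def)
  moreover have "moderate_num (\<lambda>\<epsilon>. 1 / (C * \<epsilon> powr a))"
    using moderate_num_mult[OF moderate_num_const[of "1 / C"] moderate_num_powr[of "- a"]]
    by (simp add: powr_minus field_simps)
  ultimately show ?thesis using ell C by (intro that[of p "\<lambda>\<epsilon>. C * \<epsilon> powr a"]) auto
qed

text \<open>A net bounded below by \<open>d \<epsilon> / N\<close> has a moderate reciprocal,
  because \<open>1 / d\<close> is moderate. The argument works at every
  \<open>\<xi>\<close>.\<close>

lemma G_elliptic_gen_tilde_unit:
  assumes "G_elliptic m c"
  shows "gen_tilde m c \<xi> dvd 1"
proof -
  obtain p and d :: "real \<Rightarrow> real" where p: "\<And>\<alpha>. represents_num (p \<alpha>) (c \<alpha>)"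
    and d: "moderate_num (\<lambda>\<epsilon>. 1 / d \<epsilon>)" "\<And>\<epsilon>. \<epsilon> \<in> {0<..1} \<Longrightarrow> d \<epsilon> > 0"
    and ell: "\<And>\<epsilon> \<xi>. \<epsilon> \<in> {0<..1} \<Longrightarrow> cmod (poly_fun {\<alpha>. mi_order \<alpha> = m} (\<lambda>\<alpha>. p \<alpha> \<epsilon>) \<xi>) \<ge> d \<epsilon> * norm \<xi> ^ m"
    using G_elliptic_representative[OF assms] by blast
  have mod: "moderate_num (p \<alpha>)" and c: "c = (\<lambda>\<alpha>. abs_gen_num (p \<alpha>))" for \<alpha>
    using p by (auto simp: represents_num_def fun_eq_iff)
  define T where "T = (\<lambda>\<epsilon>. tilde (poly_fun {\<alpha>. mi_order \<alpha> \<le> m} (\<lambda>\<alpha>. p \<alpha> \<epsilon>)) \<xi>)"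
  define N where "N = real (card {\<alpha> :: 'a \<Rightarrow> nat. mi_order \<alpha> = m})"
  \<comment> \<open>That the lifted operation respects the relation yields moderateness of
    \<open>T\<close>, as \<open>gen_num_rel\<close> includes it.\<close>
  have "gen_num_rel T T"
    unfolding T_def by (rule gen_tilde.rsp[unfolded rel_fun_def, rule_format])
      (use mod in \<open>auto simp: gen_num_rel_refl\<close>)
  then have T: "moderate_num T" by (simp add: gen_num_rel_def)
  have low: "N > 0 \<and> d \<epsilon> / N \<le> T \<epsilon>" if "\<epsilon> \<in> {0<..1}" for \<epsilon>
    using elliptic_card_pos[OF d(2)[OF that] ell[OF that]] elliptic_tilde_lower[OF d(2)[OF that] ell[OF that]]
    unfolding T_def N_def by simp
  have pos: "T \<epsilon> > 0" if "\<epsilon> \<in> {0<..1}" for \<epsilon>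
    using low[OF that] d(2)[OF that] by (metis divide_pos_pos order_less_le_trans)
  have inv: "moderate_num (\<lambda>\<epsilon>. 1 / T \<epsilon>)"
  proof (rule moderate_num_mono)
    show "moderate_num (\<lambda>\<epsilon>. N * (1 / d \<epsilon>))" by (intro moderate_num_mult d moderate_num_const)
    fix \<epsilon> :: real assume \<epsilon>: "\<epsilon> \<in> {0<..1}"
    show "norm (1 / T \<epsilon>) \<le> norm (N * (1 / d \<epsilon>))"
      using conjunct1[OF low[OF \<epsilon>]] conjunct2[OF low[OF \<epsilon>]] pos[OF \<epsilon>] d(2)[OF \<epsilon>]
      by (simp add: field_simps)
  qed
  have "gen_tilde m c \<xi> * abs_gen_num (\<lambda>\<epsilon>. 1 / T \<epsilon>) = abs_gen_num (\<lambda>\<epsilon>. T \<epsilon> * (1 / T \<epsilon>))"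
    unfolding c gen_tilde_abs[OF mod] T_def[symmetric]
    by (intro times_gen_num.abs_eq gen_num_rel_refl T inv)
  \<comment> \<open>Positivity of \<open>T\<close> is known on the index interval only, but this
    determines the class.\<close>
  also have "\<dots> = abs_gen_num (\<lambda>\<epsilon>. 1)"
    by (intro abs_gen_num_eqI moderate_num_mult T inv moderate_num_const) (use pos in force)
  also have "\<dots> = 1" by (rule one_gen_num.abs_eq[symmetric])
  finally show ?thesis by (metis dvd_triv_left)
qed

text \<open>Both sides are compared with \<open>(1 + norm \<xi>) ^ m\<close>: the tilde of a
  monomial lies below a multiple of it, that of the elliptic symbol above one.\<close>

lemma G_elliptic_stronger_unit:
  assumes "G_elliptic m c" "mi_order \<alpha> \<le> m"
  shows "stronger m c m (unit_coeff \<alpha>)"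
proof -
  let ?A = "{\<alpha> :: 'a \<Rightarrow> nat. mi_order \<alpha> \<le> m}"
  obtain p and d :: "real \<Rightarrow> real" where p: "\<And>\<alpha>. represents_num (p \<alpha>) (c \<alpha>)"
    and d: "moderate_num (\<lambda>\<epsilon>. 1 / d \<epsilon>)" "\<And>\<epsilon>. \<epsilon> \<in> {0<..1} \<Longrightarrow> d \<epsilon> > 0"
    and ell: "\<And>\<epsilon> \<xi>. \<epsilon> \<in> {0<..1} \<Longrightarrow> cmod (poly_fun {\<alpha>. mi_order \<alpha> = m} (\<lambda>\<alpha>. p \<alpha> \<epsilon>) \<xi>) \<ge> d \<epsilon> * norm \<xi> ^ m"
    using G_elliptic_representative[OF assms(1)] by blast
  obtain B where B: "B \<ge> 0" "\<And>\<xi>. tilde (poly_fun ?A (unit_coeff \<alpha>)) \<xi> \<le> B * (1 + norm \<xi>) ^ m"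
    using tilde_monomial_bound[OF assms(2)] by blast
  define N where "N = real (card {\<alpha> :: 'a \<Rightarrow> nat. mi_order \<alpha> = m})"
  \<comment> \<open>\<open>L\<close> is \<open>B\<close> times the factor of
    \<open>elliptic_dominates\<close> for the constant \<open>d \<epsilon>\<close>. Writing
    quotients as products with \<open>1 / d \<epsilon>\<close> exhibits it as built from moderate
    nets.\<close>
  define L where "L = (\<lambda>\<epsilon>. B * ((2 + 2 * (\<Sum>\<alpha>\<in>?A. cmod (p \<alpha> \<epsilon>)) * (1 / d \<epsilon>)) ^ m * ((N + 2) * (1 / d \<epsilon>))))"
  have "moderate_num L" unfolding L_def
    using p by (intro moderate_num_mult moderate_num_power moderate_num_add moderate_num_const
        moderate_num_sum moderate_num_norm d) (auto simp: represents_num_def)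
  moreover have "tilde (poly_fun ?A (unit_coeff \<alpha>)) \<xi> \<le> L \<epsilon> * tilde (poly_fun ?A (\<lambda>\<alpha>. p \<alpha> \<epsilon>)) \<xi>"
    if \<epsilon>: "\<epsilon> \<in> {0<..1}" for \<xi> \<epsilon>
    using order_trans[OF B(2) mult_left_mono[OF elliptic_dominates[OF d(2)[OF \<epsilon>] ell[OF \<epsilon>]] B(1)], of \<xi>]
    unfolding L_def N_def by (simp add: mult.assoc)
  moreover have "represents_poly ?A (\<lambda>\<beta> \<epsilon>. unit_coeff \<alpha> \<beta>) (unit_coeff \<alpha>)"
    by (auto simp: represents_poly_def represents_num_def zero_gen_num.abs_eq one_gen_num.abs_eq)
  moreover have "represents_poly ?A p c" using p by (simp add: represents_poly_def)
  ultimately show ?thesis unfolding stronger_def by blast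
qed

theorem proposition3p6:
  fixes m :: nat and c :: "('n::finite \<Rightarrow> nat) \<Rightarrow> 'n colombeau" and x\<^sub>0 :: "real^'n"
  assumes "G_elliptic m (\<lambda>\<alpha>. point_value (c \<alpha>) x\<^sub>0)"
  shows "\<exists>(r::nat) (cs :: nat \<Rightarrow> 'n colombeau)
      (m\<^sub>0 :: nat) (P\<^sub>0 :: ('n \<Rightarrow> nat) \<Rightarrow> complex gen_num)
      (ms :: nat \<Rightarrow> nat) (P :: nat \<Rightarrow> ('n \<Rightarrow> nat) \<Rightarrow> complex gen_num).
    diff_op m c = (\<lambda>u. const_diff_op m\<^sub>0 P\<^sub>0 u + (\<Sum>j=1..r. cs j * const_diff_op (ms j) (P j) u)) \<and>
    (\<forall>j\<in>{1..r}. point_value (cs j) x\<^sub>0 = 0) \<and>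
    (\<exists>\<xi>. gen_tilde m\<^sub>0 P\<^sub>0 \<xi> dvd 1) \<and>
    (\<forall>j\<in>{1..r}. stronger m\<^sub>0 P\<^sub>0 (ms j) (P j))"
proof -
  let ?A = "{\<alpha> :: 'n \<Rightarrow> nat. mi_order \<alpha> \<le> m}"
  define r where "r = card ?A"
  \<comment> \<open>The correction terms are numbered by the multi-indices of order at most
    \<open>m\<close>, and each \<open>P j\<close> is regarded as an operator of order
    \<open>m\<close>.\<close>
  obtain h where h: "bij_betw h {1..r} ?A"
    using ex_bij_betw_nat_finite_1[OF finite_mi] unfolding r_def by blast
  then have hA: "mi_order (h j) \<le> m" if "j \<in> {1..r}" for j using that bij_betwE by blast
  define P\<^sub>0 where "P\<^sub>0 = (\<lambda>\<alpha>. point_value (c \<alpha>) x\<^sub>0)"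
  define b where "b = (\<lambda>\<alpha>. c \<alpha> - const_fun (P\<^sub>0 \<alpha>))"
  have dec: "diff_op m c u = const_diff_op m P\<^sub>0 u + (\<Sum>j=1..r. b (h j) * const_diff_op m (unit_coeff (h j)) u)" for u
  proof -
    have "(\<Sum>j=1..r. b (h j) * const_diff_op m (unit_coeff (h j)) u) = (\<Sum>j=1..r. b (h j) * D_op (h j) u)"
      by (intro sum.cong) (simp_all only: const_diff_op_unit[OF hA])
    also have "\<dots> = (\<Sum>\<alpha>\<in>?A. b \<alpha> * D_op \<alpha> u)"
      by (rule sum.reindex_bij_betw[OF h])
    finally show ?thesis
      by (simp add: const_diff_op_def diff_op_def b_def sum.distrib[symmetric] algebra_simps)
  qed
  show ?thesis
  proof (intro exI conjI ballI)
    show "diff_op m c = (\<lambda>u. const_diff_op m P\<^sub>0 u +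
        (\<Sum>j=1..r. b (h j) * const_diff_op m (unit_coeff (h j)) u))"
      using dec by (rule ext)
    show "point_value (b (h j)) x\<^sub>0 = 0" for j
      unfolding b_def P\<^sub>0_def by (rule point_value_diff_const)
    show "gen_tilde m P\<^sub>0 0 dvd 1"
      unfolding P\<^sub>0_def by (rule G_elliptic_gen_tilde_unit[OF assms])
    show "stronger m P\<^sub>0 m (unit_coeff (h j))" if "j \<in> {1..r}" for j
      unfolding P\<^sub>0_def by (rule G_elliptic_stronger_unit[OF assms hA[OF that]])
  qed
qed

end
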